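(* There are absolute positive constants $c_1,c_2$ such that the following holds. Let $\Sigma\subset\mathbb R^n$ be a smooth connected bounded semialgebraic curve with crossing number $C(\Sigma)\ge1$. Then every algebraic computation tree with input variables $X_1,\dots,X_n$ testing membership in $\Sigma$ has height at least $c_1\log C(\Sigma)-c_2 n$.
   Context: A smooth connected bounded semialgebraic curve $\Sigma\subset\mathbb R^n$ is a smooth embedding of either the circle $S^1$ or the interval $(0,1)$. For a generic 2-dimensional linear subspace, the image of $\Sigma$ under the (orthogonal) projection to that subspace has only double points as singular points. The crossing number $C(\Sigma)$ is the maximal number of singular points of the projected image over all generic 2-dimensional linear subspaces. An algebraic computation tree with real input variables $X_1,\dots,X_n$ is a finite rooted tree with computation vertices (outdegree 1), branch vertices (outdegree 3) and leaves (outdegree 0). To each vertex $v$ a variable $Y_v$ is assigned. At a computation vertex $Y_v=a\ast b$ with $\ast\in\{+,-,\times,/\}$ and $a,b$ real constants, input variables, or variables of predecessor vertices. At a branch vertex $Y_v$ is a real constant, an input variable or a variable of a predecessor vertex, and the outgoing edges correspond to $Y_v>0$, $Y_v=0$, $Y_v<0$. An input follows the path determined by these signs to a unique leaf; leaves are labelled Yes or No, and the tree tests membership in the set of inputs reaching a Yes leaf. The height is the length of the longest root-to-leaf path. *)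

theory Defs
  imports "HOL-Analysis.Analysis"
begin

text \<open>
  The ambient dimension \<open>n\<close> is quantified inside the statement, so \<open>n\<close>-dimensional space is the
  library's \<^const>\<open>Euclidean_space\<close> \<open>n\<close>: functions \<open>nat \<Rightarrow> real\<close> vanishing from index \<open>n\<close> on.
\<close>

abbreviation Rn :: "nat \<Rightarrow> (nat \<Rightarrow> real) set"
  where "Rn n \<equiv> topspace (Euclidean_space n)"

definition dot :: "nat \<Rightarrow> (nat \<Rightarrow> real) \<Rightarrow> (nat \<Rightarrow> real) \<Rightarrow> real"
  where "dot n x y = (\<Sum>i<n. x i * y i)"

definition independent2 :: "(nat \<Rightarrow> real) \<Rightarrow> (nat \<Rightarrow> real) \<Rightarrow> bool"
  where "independent2 u v \<longleftrightarrow>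
    (\<forall>a b. (\<lambda>i. a * u i + b * v i) = (\<lambda>i. 0) \<longrightarrow> a = 0 \<and> b = 0)"

definition bounded_in :: "nat \<Rightarrow> (nat \<Rightarrow> real) set \<Rightarrow> bool"
  where "bounded_in n S \<longleftrightarrow> (\<exists>B. \<forall>x\<in>S. sqrt (dot n x x) \<le> B)"


section \<open>Semialgebraic sets\<close>

inductive polynomial_fun :: "nat \<Rightarrow> ((nat \<Rightarrow> real) \<Rightarrow> real) \<Rightarrow> bool" for n where
  const: "polynomial_fun n (\<lambda>x. c)"
| coord: "i < n \<Longrightarrow> polynomial_fun n (\<lambda>x. x i)"
| add: "polynomial_fun n p \<Longrightarrow> polynomial_fun n q \<Longrightarrow> polynomial_fun n (\<lambda>x. p x + q x)"
| mult: "polynomial_fun n p \<Longrightarrow> polynomial_fun n q \<Longrightarrow> polynomial_fun n (\<lambda>x. p x * q x)"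

inductive semialgebraic :: "nat \<Rightarrow> (nat \<Rightarrow> real) set \<Rightarrow> bool" for n where
  zero: "polynomial_fun n p \<Longrightarrow> semialgebraic n {x \<in> Rn n. p x = 0}"
| pos: "polynomial_fun n p \<Longrightarrow> semialgebraic n {x \<in> Rn n. p x > 0}"
| union: "semialgebraic n S \<Longrightarrow> semialgebraic n T \<Longrightarrow> semialgebraic n (S \<union> T)"
| inter: "semialgebraic n S \<Longrightarrow> semialgebraic n T \<Longrightarrow> semialgebraic n (S \<inter> T)"
| compl: "semialgebraic n S \<Longrightarrow> semialgebraic n (Rn n - S)"


section \<open>Smooth curves\<close>

text \<open>Smooth means of class \<open>C\<^sup>\<infinity>\<close>; the parameter sets below are always open.\<close>

definition smooth_path :: "nat \<Rightarrow> real set \<Rightarrow> (real \<Rightarrow> nat \<Rightarrow> real) \<Rightarrow> bool"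
  where "smooth_path n I g \<longleftrightarrow>
    g ` I \<subseteq> Rn n \<and> (\<forall>i<n. \<forall>k. \<forall>t\<in>I. (deriv ^^ k) (\<lambda>s. g s i) differentiable (at t))"

definition velocity :: "nat \<Rightarrow> (real \<Rightarrow> nat \<Rightarrow> real) \<Rightarrow> real \<Rightarrow> nat \<Rightarrow> real"
  where "velocity n g t = (\<lambda>i. if i < n then deriv (\<lambda>s. g s i) t else 0)"

definition smooth_immersed_path :: "nat \<Rightarrow> real set \<Rightarrow> (real \<Rightarrow> nat \<Rightarrow> real) \<Rightarrow> bool"
  where "smooth_immersed_path n I g \<longleftrightarrow>
    smooth_path n I g \<and> (\<forall>t\<in>I. velocity n g t \<noteq> (\<lambda>i. 0))"

definition smooth_arc :: "nat \<Rightarrow> (nat \<Rightarrow> real) set \<Rightarrow> bool"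
  where "smooth_arc n S \<longleftrightarrow>
    (\<exists>g. embedding_map (top_of_set {0<..<1}) (Euclidean_space n) g
       \<and> smooth_immersed_path n {0<..<1} g \<and> S = g ` {0<..<1})"

text \<open>
  The circle is the unit circle of the complex plane; a map on it is smooth (an immersion) iff its
  composition with the covering \<^const>\<open>cis\<close> is.
\<close>

definition smooth_circle :: "nat \<Rightarrow> (nat \<Rightarrow> real) set \<Rightarrow> bool"
  where "smooth_circle n S \<longleftrightarrow>
    (\<exists>f. embedding_map (top_of_set (sphere (0::complex) 1)) (Euclidean_space n) f
       \<and> smooth_immersed_path n UNIV (\<lambda>t. f (cis t)) \<and> S = f ` sphere 0 1)"

definition smooth_bounded_semialgebraic_curve :: "nat \<Rightarrow> (nat \<Rightarrow> real) set \<Rightarrow> bool"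
  where "smooth_bounded_semialgebraic_curve n S \<longleftrightarrow>
    (smooth_circle n S \<or> smooth_arc n S) \<and> bounded_in n S \<and> semialgebraic n S"

definition tangent_vector :: "nat \<Rightarrow> (nat \<Rightarrow> real) set \<Rightarrow> (nat \<Rightarrow> real) \<Rightarrow> (nat \<Rightarrow> real) \<Rightarrow> bool"
  where "tangent_vector n S x v \<longleftrightarrow>
    (\<exists>g. smooth_path n {-1<..<1} g \<and> g ` {-1<..<1} \<subseteq> S \<and> g 0 = x \<and> velocity n g 0 = v)"


section \<open>Crossing number\<close>

definition plane2 :: "nat \<Rightarrow> (nat \<Rightarrow> real) set \<Rightarrow> bool"
  where "plane2 n L \<longleftrightarrow>
    (\<exists>u\<in>Rn n. \<exists>v\<in>Rn n. independent2 u v \<and> L = {(\<lambda>i. a * u i + b * v i) | a b. True})"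

definition proj :: "nat \<Rightarrow> (nat \<Rightarrow> real) set \<Rightarrow> (nat \<Rightarrow> real) \<Rightarrow> nat \<Rightarrow> real"
  where "proj n L x = (THE y. y \<in> L \<and> (\<forall>z\<in>L. dot n (\<lambda>i. x i - y i) z = 0))"

text \<open>
  Points near which \<open>X\<close> is not a smooth curve.
\<close>

definition singular_points :: "nat \<Rightarrow> (nat \<Rightarrow> real) set \<Rightarrow> (nat \<Rightarrow> real) set"
  where "singular_points n X =
    {q \<in> X. \<not> (\<exists>U. openin (Euclidean_space n) U \<and> q \<in> U \<and> smooth_arc n (X \<inter> U))}"

text \<open>
  A double point of the projection: two branches of the curve pass through it, with different
  tangent lines, and no other piece of the image comes near it.  The last clause matters only for
  non-closed curves: it excludes that an end of the curve projects to a sequence converging to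
  the point.
\<close>

definition double_point ::
    "nat \<Rightarrow> (nat \<Rightarrow> real) set \<Rightarrow> (nat \<Rightarrow> real) set \<Rightarrow> (nat \<Rightarrow> real) \<Rightarrow> bool"
  where "double_point n S L q \<longleftrightarrow>
    (\<exists>x y. x \<noteq> y \<and> {z \<in> S. proj n L z = q} = {x, y}
       \<and> (\<exists>u v. tangent_vector n S x u \<and> tangent_vector n S y v
               \<and> independent2 (proj n L u) (proj n L v))
       \<and> (\<forall>V. openin (Euclidean_space n) V \<and> {x, y} \<subseteq> V \<longrightarrow>
            (\<exists>U. openin (Euclidean_space n) U \<and> q \<in> U
               \<and> {z \<in> S. proj n L z \<in> U} \<subseteq> V)))"

text \<open>
  Genericity is the usual notion of a regular projection: an immersion whose image has only double
  points as singular points, and which is injective over the non-singular points of the image.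
\<close>

definition generic_plane :: "nat \<Rightarrow> (nat \<Rightarrow> real) set \<Rightarrow> (nat \<Rightarrow> real) set \<Rightarrow> bool"
  where "generic_plane n S L \<longleftrightarrow>
    plane2 n L
    \<and> (\<forall>x\<in>S. \<forall>v. tangent_vector n S x v \<and> v \<noteq> (\<lambda>i. 0) \<longrightarrow> proj n L v \<noteq> (\<lambda>i. 0))
    \<and> (\<forall>q \<in> singular_points n (proj n L ` S). double_point n S L q)
    \<and> (\<forall>q \<in> proj n L ` S - singular_points n (proj n L ` S). \<exists>!x. x \<in> S \<and> proj n L x = q)"

text \<open>
  For semialgebraic \<open>S\<close> these cardinalities are finite and bounded, so the supremum is a maximum;
  for \<open>n < 2\<close>, where there are no planes, it is \<open>0\<close>.
\<close>

definition crossing_number :: "nat \<Rightarrow> (nat \<Rightarrow> real) set \<Rightarrow> nat"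
  where "crossing_number n S =
    (SUP L \<in> {L. generic_plane n S L}. card (singular_points n (proj n L ` S)))"


section \<open>Algebraic computation trees\<close>

text \<open>
  \<open>Pred j\<close> is the variable of the proper ancestor that is reached by going up \<open>Suc j\<close> edges.
  \<open>Input i\<close> is the input variable with index \<open>i + 1\<close>.
  The children of a branch vertex are listed in the order: positive, zero, negative.
\<close>

datatype operand = Const real | Input nat | Pred nat

datatype operation = Add | Sub | Mul | Div

datatype act =
    Leaf bool
  | Compute operation operand operand act
  | Branch operand act act act

fun wf_operand :: "nat \<Rightarrow> nat \<Rightarrow> operand \<Rightarrow> bool" where
  "wf_operand n k (Const c) \<longleftrightarrow> True"
| "wf_operand n k (Input i) \<longleftrightarrow> i < n"
| "wf_operand n k (Pred j) \<longleftrightarrow> j < k"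

text \<open>\<open>k\<close> is the number of ancestors of the root of the given (sub)tree.\<close>

fun wf_act :: "nat \<Rightarrow> nat \<Rightarrow> act \<Rightarrow> bool" where
  "wf_act n k (Leaf b) \<longleftrightarrow> True"
| "wf_act n k (Compute f a b t) \<longleftrightarrow> wf_operand n k a \<and> wf_operand n k b \<and> wf_act n (Suc k) t"
| "wf_act n k (Branch a p z m) \<longleftrightarrow>
    wf_operand n k a \<and> wf_act n (Suc k) p \<and> wf_act n (Suc k) z \<and> wf_act n (Suc k) m"

fun operand_val :: "(nat \<Rightarrow> real) \<Rightarrow> real list \<Rightarrow> operand \<Rightarrow> real" where
  "operand_val x ys (Const c) = c"
| "operand_val x ys (Input i) = x i"
| "operand_val x ys (Pred j) = ys ! j"

fun apply_operation :: "operation \<Rightarrow> real \<Rightarrow> real \<Rightarrow> real option" where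
  "apply_operation Add a b = Some (a + b)"
| "apply_operation Sub a b = Some (a - b)"
| "apply_operation Mul a b = Some (a * b)"
| "apply_operation Div a b = (if b = 0 then None else Some (a / b))"

text \<open>
  \<open>ys\<close> lists the values of the ancestors' variables, nearest first.  The result is the label of the
  leaf reached, or \<^const>\<open>None\<close> if the input is stopped by a division by zero.
\<close>

fun run :: "(nat \<Rightarrow> real) \<Rightarrow> real list \<Rightarrow> act \<Rightarrow> bool option" where
  "run x ys (Leaf b) = Some b"
| "run x ys (Compute f a b t) =
    (case apply_operation f (operand_val x ys a) (operand_val x ys b) of
       None \<Rightarrow> None
     | Some y \<Rightarrow> run x (y # ys) t)"
| "run x ys (Branch a p z m) =
    (let y = operand_val x ys a in
       if y > 0 then run x (y # ys) p
       else if y = 0 then run x (y # ys) z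
       else run x (y # ys) m)"

definition tests_membership :: "nat \<Rightarrow> act \<Rightarrow> (nat \<Rightarrow> real) set \<Rightarrow> bool"
  where "tests_membership n t S \<longleftrightarrow> S = {x \<in> Rn n. run x [] t = Some True}"

fun act_height :: "act \<Rightarrow> nat" where
  "act_height (Leaf b) = 0"
| "act_height (Compute f a b t) = Suc (act_height t)"
| "act_height (Branch a p z m) = Suc (max (act_height p) (max (act_height z) (act_height m)))"

end

theory Submission
  imports Defs
begin

text \<open>
  A double point of a generic projection of \<open>\<Sigma>\<close> comes from a pair \<open>(x, y)\<close> of points of \<open>\<Sigma>\<close> with the
  same projection; since the two branches are transversal there, the pair is isolated among all such
  pairs.  Adjoining the intermediate values computed by the tree on \<open>x\<close> and on \<open>y\<close> turns it into an
  isolated zero of one of at most \<open>9\<^sup>h\<close> sums of squares of quadratic polynomials in \<open>2(n + h)\<close>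
  variables, where \<open>h\<close> is the height; strict inequalities and nonvanishing denominators are open
  conditions and can be dropped.  A nonnegative polynomial of degree 4 in \<open>N\<close> variables has at most
  \<open>5\<^sup>N\<close> isolated zeros: adding \<open>\<epsilon> \<Sum> x\<^sub>i\<^sup>6\<close> produces a critical point near each of them, and the
  critical points solve a system \<open>x\<^sub>i\<^sup>5 = r\<^sub>i(x)\<close> with \<open>deg r\<^sub>i \<le> 4\<close>.
\<close>

section \<open>Zeros of polynomial systems\<close>

text \<open>Intermediate values stay variables because eliminating them would let the degree grow
  exponentially with the height; as variables they cost only extra dimensions, and the degree stays
  at 4. The systems have many unwanted zeros: the pairs \<open>(x, x)\<close> solve the projection
  equations along a whole curve, and dropping inequalities and denominators admits points that the
  tree rejects. Hence the count asks nothing of a polynomial globally. It bounds any finite set of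
  isolated zeros, and isolation is a local matter in which the dropped conditions still hold.
  Summing squares turns an overdetermined system into one nonnegative function, whose critical point
  equations are as many as the unknowns. The exponent 6 is even, which keeps the perturbation
  nonnegative, and exceeds 4, so that after differentiation the pure fifth powers dominate. A fifth
  power can then always be rewritten in lower degree, leaving the exponents 0 to 4: this is the base
  5.\<close>

inductive pdeg :: "'i set \<Rightarrow> nat \<Rightarrow> (('i \<Rightarrow> real) \<Rightarrow> real) \<Rightarrow> bool" for I where
  const: "pdeg I d (\<lambda>x. c)"
| add: "pdeg I d f \<Longrightarrow> pdeg I d g \<Longrightarrow> pdeg I d (\<lambda>x. f x + g x)"
| coord_mult: "i \<in> I \<Longrightarrow> pdeg I d f \<Longrightarrow> pdeg I (Suc d) (\<lambda>x. x i * f x)"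

lemma pdeg_mono: "pdeg I d f \<Longrightarrow> d \<le> e \<Longrightarrow> pdeg I e f"
proof (induction arbitrary: e rule: pdeg.induct)
  case (coord_mult i d f)
  then obtain e' where "e = Suc e'" "d \<le> e'" by (cases e) auto
  then show ?case using pdeg.coord_mult[OF coord_mult.hyps(1) coord_mult.IH, of e'] by simp
qed (auto intro: pdeg.intros)

lemma pdeg_cmult: "pdeg I d f \<Longrightarrow> pdeg I d (\<lambda>x. c * f x)"
proof (induction rule: pdeg.induct)
  case (coord_mult i d f)
  have "(\<lambda>x. c * (x i * f x)) = (\<lambda>x. x i * (c * f x))" by (simp add: fun_eq_iff)
  then show ?case using coord_mult pdeg.coord_mult by metis
qed (auto intro: pdeg.intros simp: distrib_left)

lemma pdeg_mult: "pdeg I d f \<Longrightarrow> pdeg I e g \<Longrightarrow> pdeg I (d + e) (\<lambda>x. f x * g x)"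
proof (induction rule: pdeg.induct)
  case (const d c)
  then show ?case using pdeg_cmult pdeg_mono le_add2 by blast
next
  case (coord_mult i d f)
  then show ?case using pdeg.coord_mult[of i I "d + e" "\<lambda>x. f x * g x"] by (simp add: mult.assoc)
qed (auto intro: pdeg.intros simp: distrib_right)

lemma pdeg_diff: "pdeg I d f \<Longrightarrow> pdeg I d g \<Longrightarrow> pdeg I d (\<lambda>x. f x - g x)"
  using pdeg.add[of I d f "\<lambda>x. (-1) * g x"] pdeg_cmult[of I d g "-1"] by simp

lemma pdeg_coord: "i \<in> I \<Longrightarrow> pdeg I (Suc d) (\<lambda>x. x i)"
  using pdeg.coord_mult[OF _ pdeg.const, of i I d 1] by simp

lemma pdeg_sum: "(\<And>j. j \<in> J \<Longrightarrow> pdeg I d (f j)) \<Longrightarrow> pdeg I d (\<lambda>x. \<Sum>j\<in>J. f j x)"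
proof (induction J rule: infinite_finite_induct)
  case (insert j J)
  then show ?case using pdeg.add[of I d "f j" "\<lambda>x. \<Sum>j\<in>J. f j x"] by simp
qed (auto intro: pdeg.intros)

lemma pdeg_power2: "pdeg I d f \<Longrightarrow> pdeg I (2 * d) (\<lambda>x. (f x)\<^sup>2)"
  using pdeg_mult[of I d f d f] by (simp add: power2_eq_square mult_2)

lemma pdeg_reindex: "pdeg I d f \<Longrightarrow> h ` I \<subseteq> J \<Longrightarrow> pdeg J d (\<lambda>w. f (\<lambda>i. w (h i)))"
  by (induction rule: pdeg.induct) (auto intro: pdeg.intros)

lemma pdeg_continuous: "pdeg I d f \<Longrightarrow> continuous_on UNIV f"
  by (induction rule: pdeg.induct) (intro continuous_intros continuous_on_product_coordinates; assumption)+

text \<open>The degree of the derivative is not sharp, but this form also covers degree 0.\<close>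

lemma pdeg_partial_derivative:
  assumes "pdeg I d f"
  obtains f' where "pdeg I d f'"
    "\<And>w. ((\<lambda>s. f (w(i := s))) has_real_derivative f' w) (at (w i))"
proof -
  have "\<exists>f'. pdeg I d f' \<and> (\<forall>w. ((\<lambda>s. f (w(i := s))) has_real_derivative f' w) (at (w i)))"
    using assms
  proof induction
    case (const d c)
    show ?case by (rule exI[of _ "\<lambda>w. 0"]) (auto intro: pdeg.intros)
  next
    case (add d f g)
    then obtain f' g' where
      "pdeg I d f'" "\<forall>w. ((\<lambda>s. f (w(i := s))) has_real_derivative f' w) (at (w i))"
      "pdeg I d g'" "\<forall>w. ((\<lambda>s. g (w(i := s))) has_real_derivative g' w) (at (w i))" by blast
    then show ?case
      by (intro exI[of _ "\<lambda>w. f' w + g' w"]) (auto simp del: fun_upd_apply intro!: pdeg.intros DERIV_add)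
  next
    case (coord_mult j d f)
    then obtain f' where f': "pdeg I d f'"
      "\<And>w. ((\<lambda>s. f (w(i := s))) has_real_derivative f' w) (at (w i))" by blast
    show ?case
    proof (cases "j = i")
      case True
      have "((\<lambda>s. (w(i := s)) j * f (w(i := s))) has_real_derivative f w + w j * f' w) (at (w i))" for w
        using DERIV_mult[OF DERIV_ident f'(2)[of w]] True by (simp add: algebra_simps)
      moreover have "pdeg I (Suc d) (\<lambda>w. f w + w j * f' w)"
        using coord_mult f' pdeg_mono[OF coord_mult.hyps(2), of "Suc d"]
        by (intro pdeg.add pdeg.coord_mult) auto
      ultimately show ?thesis by blast
    next
      case False
      have "((\<lambda>s. (w(i := s)) j * f (w(i := s))) has_real_derivative w j * f' w) (at (w i))" for w
        using DERIV_cmult[OF f'(2)[of w], of "w j"] False by simp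
      moreover have "pdeg I (Suc d) (\<lambda>w. w j * f' w)"
        using coord_mult f' by (intro pdeg.coord_mult) auto
      ultimately show ?thesis by blast
    qed
  qed
  then show ?thesis using that by blast
qed

section \<open>Linear algebra for pure power systems\<close>

text \<open>Gaussian elimination, one equation per induction step. It will be applied with points as
  unknowns and monomials as equations.\<close>

lemma homogeneous_system_nontrivial_solution:
  fixes f :: "'m \<Rightarrow> 'z \<Rightarrow> real"
  assumes "finite M" "finite Z" "card M < card Z"
  shows "\<exists>c. (\<exists>z\<in>Z. c z \<noteq> 0) \<and> (\<forall>m\<in>M. (\<Sum>z\<in>Z. c z * f m z) = 0)"
  using assms
proof (induction M arbitrary: Z f rule: finite_induct)
  case empty
  then show ?case by (intro exI[of _ "\<lambda>_. 1"]) (auto simp: card_gt_0_iff)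
next
  case (insert m M)
  show ?case
  proof (cases "\<forall>z\<in>Z. f m z = 0")
    case True
    then show ?thesis using insert.IH[of Z f] insert by auto
  next
    case False
    then obtain y where y: "y \<in> Z" "f m y \<noteq> 0" by blast
    define Y where "Y = Z - {y}"
    \<comment> \<open>Equation \<open>m\<close> is solved for the unknown at the pivot
      \<open>y\<close>; \<open>g\<close> holds the coefficients of the other equations after
      substitution.\<close>
    define g where "g k z = f k z - f m z / f m y * f k y" for k z
    have Y: "finite Y" "card M < card Y" "y \<notin> Y" "Z = insert y Y"
      using insert y by (auto simp: Y_def)
    obtain c where c: "\<exists>z\<in>Y. c z \<noteq> 0" "\<And>k. k \<in> M \<Longrightarrow> (\<Sum>z\<in>Y. c z * g k z) = 0"
      using insert.IH[of Y g] Y by blast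
    \<comment> \<open>Back substitution: the value at \<open>y\<close> is the one that equation
      \<open>m\<close> forces.\<close>
    define b where "b = c(y := - (\<Sum>z\<in>Y. c z * f m z) / f m y)"
    have b: "(\<Sum>z\<in>Z. b z * f k z) = - (\<Sum>z\<in>Y. c z * f m z) / f m y * f k y + (\<Sum>z\<in>Y. c z * f k z)" for k
    proof -
      have "(\<Sum>z\<in>Y. b z * f k z) = (\<Sum>z\<in>Y. c z * f k z)"
        using Y by (intro sum.cong) (auto simp: b_def)
      then show ?thesis using Y by (simp add: b_def)
    qed
    have "(\<Sum>z\<in>Z. b z * f k z) = 0" if "k \<in> M" for k
      using c(2)[OF that]
      by (simp add: b g_def right_diff_distrib sum_subtractf sum_distrib_right sum_divide_distrib
          sum_negf mult.assoc)
    moreover have "(\<Sum>z\<in>Z. b z * f m z) = 0" using y b[of m] by simp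
    moreover have "\<exists>z\<in>Z. b z \<noteq> 0" using c(1) Y by (auto simp: b_def)
    ultimately show ?thesis by blast
  qed
qed

definition monom_fun :: "'i set \<Rightarrow> ('i \<Rightarrow> nat) \<Rightarrow> ('i \<Rightarrow> real) \<Rightarrow> real"
  where "monom_fun I a x = (\<Prod>i\<in>I. x i ^ a i)"

lemma monom_fun_upd:
  assumes "finite I" "i \<in> I"
  shows "monom_fun I (a(i := a i + k)) x = x i ^ k * monom_fun I a x"
proof -
  have "(\<Prod>j\<in>I - {i}. x j ^ (a(i := a i + k)) j) = (\<Prod>j\<in>I - {i}. x j ^ a j)"
    by (intro prod.cong) auto
  then show ?thesis using assms by (simp add: monom_fun_def prod.remove power_add mult_ac)
qed

lemma sum_fun_upd_add:
  fixes a :: "'i \<Rightarrow> nat"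
  assumes "finite I" "i \<in> I"
  shows "sum (a(i := a i + k)) I = k + sum a I"
proof -
  have "sum (a(i := a i + k)) (I - {i}) = sum a (I - {i})"
    by (intro sum.cong) auto
  then show ?thesis using assms by (simp add: sum.remove)
qed

text \<open>Each coordinate factor of \<open>f\<close> is moved into the exponent \<open>e\<close>,
  which is why \<open>e\<close> is general in the induction. Only monomials of total degree at most
  \<open>d + sum e I\<close> arise.\<close>

lemma weighted_sum_pdeg_eq_0:
  assumes I: "finite I" and f: "pdeg I d f" "d + sum e I < s"
    and monom: "\<And>a. sum a I < s \<Longrightarrow> (\<Sum>z\<in>Z. c z * monom_fun I a z) = 0"
  shows "(\<Sum>z\<in>Z. c z * (f z * monom_fun I e z)) = 0"
  using f
proof (induction arbitrary: e rule: pdeg.induct)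
  case (const d k)
  have "(\<Sum>z\<in>Z. c z * (k * monom_fun I e z)) = k * (\<Sum>z\<in>Z. c z * monom_fun I e z)"
    by (simp add: sum_distrib_left mult_ac)
  then show ?case using monom[of e] const by simp
next
  case (add d f g)
  then show ?case by (simp add: algebra_simps sum.distrib)
next
  case (coord_mult j d f)
  have "(\<Sum>z\<in>Z. c z * (f z * monom_fun I (e(j := e j + 1)) z)) = 0"
    using coord_mult sum_fun_upd_add[OF I coord_mult.hyps(1), of e 1]
    by (intro coord_mult.IH) simp
  then show ?case
    using monom_fun_upd[OF I coord_mult.hyps(1), of e 1] by (simp add: mult_ac)
qed

text \<open>
  Modulo the equations, every monomial reduces to monomials with all exponents below 5, so these
  span all functions on the finite set \<open>Z\<close>.
\<close>

lemma card_zeros_pure_power_system: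
  fixes r :: "'i \<Rightarrow> ('i \<Rightarrow> real) \<Rightarrow> real"
  assumes I: "finite I" and Z: "finite Z"
    and supp: "\<And>z i. z \<in> Z \<Longrightarrow> i \<notin> I \<Longrightarrow> z i = 0"
    and r: "\<And>i. i \<in> I \<Longrightarrow> pdeg I 4 (r i)"
    and zero: "\<And>z i. z \<in> Z \<Longrightarrow> i \<in> I \<Longrightarrow> z i ^ 5 = r i z"
  shows "card Z \<le> 5 ^ card I"
proof (rule ccontr)
  define M where "M = (\<Pi>\<^sub>E i\<in>I. {..<5::nat})"
  assume "\<not> card Z \<le> 5 ^ card I"
  then have "finite M" "card M < card Z"
    using I by (auto simp: M_def card_PiE finite_PiE)
  \<comment> \<open>The weights \<open>c\<close> form a nonzero linear functional on the functions
    on \<open>Z\<close> that kills all reduced monomials. The aim is that it kills every polynomial,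
    although some polynomial separates any one point from the rest of \<open>Z\<close>.\<close>
  then obtain c where c: "\<exists>z\<in>Z. c z \<noteq> 0" and
    M0: "\<And>a. a \<in> M \<Longrightarrow> (\<Sum>z\<in>Z. c z * monom_fun I a z) = 0"
    using homogeneous_system_nontrivial_solution[OF _ Z, of M "monom_fun I"] by blast
  have monom0: "(\<Sum>z\<in>Z. c z * monom_fun I a z) = 0" for a
  \<comment> \<open>Replacing a factor of degree 5 by \<open>r i\<close>, of degree at most 4,
    lowers the total degree, so the induction terminates.\<close>
  proof (induction "sum a I" arbitrary: a rule: less_induct)
    case less
    show ?case
    proof (cases "\<forall>i\<in>I. a i < 5")
      case True
      then have "restrict a I \<in> M" by (auto simp: M_def)
      moreover have "monom_fun I (restrict a I) = monom_fun I a"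
        by (auto simp: monom_fun_def fun_eq_iff intro: prod.cong)
      ultimately show ?thesis using M0 by metis
    next
      case False
      then obtain i where i: "i \<in> I" "5 \<le> a i" by (auto simp: not_less)
      define b where "b = a(i := a i - 5)"
      have a: "a = b(i := b i + 5)" using i by (auto simp: b_def fun_eq_iff)
      have "sum a I = 5 + sum b I" using sum_fun_upd_add[OF I i(1), of b 5] a by simp
      then have "(\<Sum>z\<in>Z. c z * (r i z * monom_fun I b z)) = 0"
        using less by (intro weighted_sum_pdeg_eq_0[OF I r[OF i(1)], of b "sum a I"]) simp_all
      moreover have "monom_fun I a z = r i z * monom_fun I b z" if "z \<in> Z" for z
      proof -
        have "monom_fun I a z = z i ^ 5 * monom_fun I b z"
          by (subst a) (rule monom_fun_upd[OF I i(1)])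
        then show ?thesis using zero[OF that i(1)] by simp
      qed
      ultimately show ?thesis by (simp cong: sum.cong)
    qed
  qed
  have poly0: "(\<Sum>z\<in>Z. c z * (f z * monom_fun I e z)) = 0" if "pdeg I d f" for d f e
    using monom0 by (intro weighted_sum_pdeg_eq_0[OF I that, of e "Suc (d + sum e I)"]) simp_all
  obtain z where z: "z \<in> Z" "c z \<noteq> 0" using c by blast
  \<comment> \<open>A Lagrange polynomial: it vanishes on \<open>Z\<close> outside \<open>z\<close>
    and, as distinct points of \<open>Z\<close> differ on \<open>I\<close>, not at
    \<open>z\<close>.\<close>
  define L where "L = (\<lambda>x. \<Prod>y\<in>Z - {z}. \<Sum>i\<in>I. (x i - y i)\<^sup>2)"
  have L: "pdeg I (card Y * 2) (\<lambda>x. \<Prod>y\<in>Y. \<Sum>i\<in>I. (x i - y i)\<^sup>2)" if "finite Y" for Y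
    using that
  proof induction
    case empty
    show ?case by (simp add: pdeg.const)
  next
    case (insert y Y)
    have "pdeg I (2 * 1) (\<lambda>x. \<Sum>i\<in>I. (x i - y i)\<^sup>2)"
      by (intro pdeg_sum pdeg_power2 pdeg_diff pdeg.const) (auto intro: pdeg_coord[of _ _ 0, simplified])
    from pdeg_mult[OF this insert.IH] show ?case using insert by simp
  qed
  have "L y = 0" if "y \<in> Z" "y \<noteq> z" for y
    unfolding L_def using that Z by (intro prod_zero) (auto intro!: bexI[of _ y])
  then have "(\<Sum>y\<in>Z. c y * (L y * monom_fun I (\<lambda>_. 0) y)) = (\<Sum>y\<in>{z}. c y * L y)"
    using z Z by (intro sum.mono_neutral_cong_right) (auto simp: monom_fun_def)
  then have "c z * L z = 0" using poly0[OF L[of "Z - {z}"], of "\<lambda>_. 0"] Z by (simp add: L_def)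
  then obtain y where y: "y \<in> Z" "y \<noteq> z" "(\<Sum>i\<in>I. (z i - y i)\<^sup>2) = 0"
    using z Z by (auto simp: L_def)
  then have "z i = y i" if "i \<in> I" for i
    using that I by (simp add: sum_nonneg_eq_0_iff)
  then have "z = y" using supp y(1) z(1) by (metis ext)
  then show False using y by simp
qed

section \<open>Isolated zeros and perturbed critical points\<close>

text \<open>A basic neighbourhood in the product topology constrains only finitely many coordinates,
  so one radius serves for all of them.\<close>

lemma eventually_nhds_fun_cube:
  fixes z :: "'i \<Rightarrow> real"
  assumes "\<forall>\<^sub>F w in nhds z. Q w"
  obtains J e where "finite J" "e > 0" "\<And>w. (\<And>i. i \<in> J \<Longrightarrow> \<bar>w i - z i\<bar> \<le> e) \<Longrightarrow> Q w"
proof -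
  obtain U where U: "open U" "z \<in> U" "\<And>w. w \<in> U \<Longrightarrow> Q w"
    using assms by (auto simp: eventually_nhds)
  obtain X where X: "z \<in> (\<Pi>\<^sub>E i\<in>UNIV. X i)" "\<And>i. open (X i)"
    "finite {i. X i \<noteq> UNIV}" "(\<Pi>\<^sub>E i\<in>UNIV. X i) \<subseteq> U"
    using product_topology_open_contains_basis[of "\<lambda>_. euclidean" UNIV U z] U
    by (auto simp: open_fun_def)
  have "\<forall>i. \<exists>e>0. cball (z i) e \<subseteq> X i"
    using X(1,2) open_contains_cball by (metis PiE_mem UNIV_I)
  then obtain e where e: "\<And>i. e i > 0" "\<And>i. cball (z i) (e i) \<subseteq> X i" by metis
  define J where "J = {i. X i \<noteq> UNIV}"
  have J: "finite J" using X(3) by (simp add: J_def)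
  define d where "d = Min (insert 1 (e ` J))"
  have d: "d > 0" "\<And>i. i \<in> J \<Longrightarrow> d \<le> e i" using e(1) J by (auto simp: d_def)
  have "Q w" if w: "\<And>i. i \<in> J \<Longrightarrow> \<bar>w i - z i\<bar> \<le> d" for w
  proof -
    have "w i \<in> X i" for i
    proof (cases "i \<in> J")
      case True
      then have "w i \<in> cball (z i) (e i)"
        using w d(2) by (fastforce simp: dist_real_def abs_minus_commute)
      then show ?thesis using e(2) by blast
    qed (auto simp: J_def)
    then show ?thesis using X(4) U(3) by blast
  qed
  then show ?thesis using that J d(1) by blast
qed

text \<open>Tychonoff's theorem. The factors outside the finite set of variables will be
  \<open>{0}\<close>.\<close>

lemma compact_fun_box:
  fixes K :: "'i \<Rightarrow> real set"
  assumes "\<And>i. compact (K i)"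
  shows "compact {w. \<forall>i. w i \<in> K i}"
proof -
  have "compactin (product_topology (\<lambda>i::'i. euclidean) UNIV) (\<Pi>\<^sub>E i\<in>UNIV. K i)"
    unfolding compactin_PiE using assms by simp
  moreover have "(\<Pi>\<^sub>E i\<in>UNIV. K i) = {w. \<forall>i. w i \<in> K i}" by (auto simp: PiE_iff)
  ultimately show ?thesis by (simp add: euclidean_product_topology)
qed

text \<open>
  An isolated zero of a nonnegative polynomial is a strict local minimum, so a small perturbation
  still has a local minimum nearby.  Perturbing by a multiple of \<open>\<Sum> x\<^sub>i\<^sup>6\<close> makes the critical
  point equations of the form treated above.
\<close>

lemma card_isolated_zeros_le:
  fixes P :: "('i \<Rightarrow> real) \<Rightarrow> real"
  assumes I: "finite I" and P: "pdeg I 4 P" and nonneg: "\<And>w. P w \<ge> 0" and Z: "finite Z"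
    and supp: "\<And>z i. z \<in> Z \<Longrightarrow> i \<notin> I \<Longrightarrow> z i = 0"
    and zero: "\<And>z. z \<in> Z \<Longrightarrow> P z = 0"
    and isolated: "\<And>z. z \<in> Z \<Longrightarrow> \<forall>\<^sub>F w in nhds z. (\<forall>i. i \<notin> I \<longrightarrow> w i = 0) \<longrightarrow> P w = 0 \<longrightarrow> w = z"
  shows "card Z \<le> 5 ^ card I"
proof -
  define cube where "cube z e = {w. (\<forall>i\<in>I. \<bar>w i - z i\<bar> \<le> e) \<and> (\<forall>i. i \<notin> I \<longrightarrow> w i = 0)}"
    for z :: "'i \<Rightarrow> real" and e
  have "\<exists>e>0. \<forall>w\<in>cube z e. P w = 0 \<longrightarrow> w = z" if z: "z \<in> Z" for z
  proof -
    obtain J e where J: "e > 0" "\<And>w. (\<And>i. i \<in> J \<Longrightarrow> \<bar>w i - z i\<bar> \<le> e) \<Longrightarrow>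
        (\<forall>i. i \<notin> I \<longrightarrow> w i = 0) \<longrightarrow> P w = 0 \<longrightarrow> w = z"
      using eventually_nhds_fun_cube[OF isolated[OF z]] by metis
    have "w = z" if w: "w \<in> cube z e" "P w = 0" for w
    proof -
      have "\<bar>w i - z i\<bar> \<le> e" for i
        using w(1) supp[OF z, of i] J(1) by (cases "i \<in> I") (auto simp: cube_def)
      then show ?thesis using J(2)[of w] w by (simp add: cube_def)
    qed
    then show ?thesis using J(1) by blast
  qed
  then obtain e where e: "\<And>z. z \<in> Z \<Longrightarrow> e z > 0"
    "\<And>z w. z \<in> Z \<Longrightarrow> w \<in> cube z (e z) \<Longrightarrow> P w = 0 \<Longrightarrow> w = z" by metis
  \<comment> \<open>Half the isolation radius: if two zeros led to the same critical point, they
    would be within \<open>2 * d\<close> of each other and hence equal.\<close>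
  define d where "d = Min (insert 1 (e ` Z)) / 2"
  have d: "d > 0" "\<And>z. z \<in> Z \<Longrightarrow> 2 * d \<le> e z" using e(1) Z by (auto simp: d_def)
  have unique: "w = z" if "z \<in> Z" "w \<in> cube z d" "P w = 0" for z w
  proof (rule e(2)[OF that(1) _ that(3)])
    show "w \<in> cube z (e z)" using that(2) d(1) d(2)[OF that(1)] by (fastforce simp: cube_def)
  qed
  have compact: "compact (cube z d)" for z
  proof -
    have "cube z d = {w. \<forall>i. w i \<in> (if i \<in> I then {z i - d..z i + d} else {0})}"
      by (force simp: cube_def abs_le_iff split: if_splits)
    then show ?thesis using compact_fun_box[of "\<lambda>i. if i \<in> I then {z i - d..z i + d} else {0}"] by simp
  qed
  have cont: "continuous_on A P" for A
    using pdeg_continuous[OF P] continuous_on_subset by blast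
  \<comment> \<open>The faces of the cube are compact and contain no zero, so \<open>P\<close> has a
    positive minimum there. For empty \<open>I\<close> there are no faces, hence the case
    split.\<close>
  have gap: "\<exists>\<delta>>0. \<forall>w\<in>cube z d. (\<exists>i\<in>I. \<bar>w i - z i\<bar> = d) \<longrightarrow> \<delta> \<le> P w" if z: "z \<in> Z" for z
  proof -
    define B where "B = cube z d \<inter> (\<Union>i\<in>I. {w. \<bar>w i - z i\<bar> = d})"
    have "closed {w :: 'i \<Rightarrow> real. \<bar>w i - z i\<bar> = d}" for i
      by (intro closed_Collect_eq continuous_intros continuous_on_product_coordinates)
    then have B: "compact B" unfolding B_def using compact I by (intro compact_Int_closed closed_UN) auto
    show ?thesis
    proof (cases "B = {}")
      case True
      then show ?thesis by (intro exI[of _ 1]) (auto simp: B_def)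
    next
      case False
      then obtain b where b: "b \<in> B" "\<And>w. w \<in> B \<Longrightarrow> P b \<le> P w"
        using continuous_attains_inf[OF B _ cont] by blast
      have "P b \<noteq> 0"
      proof
        assume "P b = 0"
        then have "b = z" using unique[OF z] b(1) by (auto simp: B_def)
        then show False using b(1) d(1) by (auto simp: B_def)
      qed
      then have "P b > 0" using nonneg[of b] by simp
      then show ?thesis using b(2) by (intro exI[of _ "P b"]) (auto simp: B_def)
    qed
  qed
  have "\<forall>i. \<exists>D. pdeg I 4 D \<and> (\<forall>w. ((\<lambda>s. P (w(i := s))) has_real_derivative D w) (at (w i)))"
    using pdeg_partial_derivative[OF P] by metis
  then obtain D where D: "\<And>i. pdeg I 4 (D i)"
    "\<And>i w. ((\<lambda>s. P (w(i := s))) has_real_derivative D i w) (at (w i))" by metis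
  \<comment> \<open>One perturbation must serve all zeros at once; an eventual statement can be
    intersected over the finite set \<open>Z\<close>.\<close>
  have crit: "\<forall>\<^sub>F \<epsilon> in at_right 0. \<exists>w\<in>cube z d. \<forall>i\<in>I. D i w + 6 * \<epsilon> * w i ^ 5 = 0"
    if z: "z \<in> Z" for z
  proof -
    obtain \<delta> where \<delta>: "\<delta> > 0"
      "\<And>w i. w \<in> cube z d \<Longrightarrow> i \<in> I \<Longrightarrow> \<bar>w i - z i\<bar> = d \<Longrightarrow> \<delta> \<le> P w"
      using gap[OF z] by metis
    define N where "N w = (\<Sum>i\<in>I. w i ^ 6)" for w :: "'i \<Rightarrow> real"
    have "((\<lambda>\<epsilon>. \<epsilon> * N z) \<longlongrightarrow> 0 * N z) (at_right 0)" by (intro tendsto_intros)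
    then have "\<forall>\<^sub>F \<epsilon> in at_right 0. \<epsilon> * N z < \<delta>" using \<delta>(1) by (auto dest: order_tendstoD(2))
    moreover have "\<forall>\<^sub>F \<epsilon> in at_right (0::real). \<epsilon> > 0" by (simp add: eventually_at_right_less)
    ultimately show ?thesis
    proof eventually_elim
      case (elim \<epsilon>)
      \<comment> \<open>At a minimum \<open>w\<close> of \<open>f\<close> on the cube,
        \<open>P w \<le> f w \<le> f z < \<delta>\<close>. So \<open>w\<close> lies on no face, and
        every partial derivative of \<open>f\<close> in \<open>I\<close> vanishes at
        \<open>w\<close>.\<close>
      define f where "f w = P w + \<epsilon> * N w" for w
      have "continuous_on (cube z d) f" unfolding f_def N_def
        by (intro continuous_intros cont continuous_on_subset[OF continuous_on_product_coordinates]) auto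
      moreover have z': "z \<in> cube z d" using supp[OF z] d(1) by (simp add: cube_def)
      ultimately obtain w where w: "w \<in> cube z d" "\<And>v. v \<in> cube z d \<Longrightarrow> f w \<le> f v"
        using continuous_attains_inf[OF compact, of z f] by blast
      have "N w \<ge> 0" by (simp add: N_def sum_nonneg)
      then have "P w \<le> f w" using elim by (simp add: f_def)
      also have "f w \<le> f z" using w(2) z' by blast
      also have "f z < \<delta>" using elim zero[OF z] by (simp add: f_def)
      finally have "P w < \<delta>" .
      have "D i w + 6 * \<epsilon> * w i ^ 5 = 0" if i: "i \<in> I" for i
      proof -
        have "\<bar>w i - z i\<bar> \<noteq> d" using \<delta>(2)[OF w(1) i] \<open>P w < \<delta>\<close> by linarith
        then have lt: "\<bar>w i - z i\<bar> < d" using w(1) i by (force simp: cube_def)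
        have N: "N (w(i := s)) = s ^ 6 + (\<Sum>j\<in>I - {i}. w j ^ 6)" for s
        proof -
          have "(\<Sum>j\<in>I - {i}. (w(i := s)) j ^ 6) = (\<Sum>j\<in>I - {i}. w j ^ 6)"
            by (intro sum.cong) auto
          then show ?thesis using I i by (simp add: N_def sum.remove)
        qed
        have "((\<lambda>s. \<epsilon> * N (w(i := s))) has_real_derivative 6 * \<epsilon> * w i ^ 5) (at (w i))"
          unfolding N by (auto intro!: derivative_eq_intros)
        then have "((\<lambda>s. f (w(i := s))) has_real_derivative D i w + 6 * \<epsilon> * w i ^ 5) (at (w i))"
          unfolding f_def by (intro DERIV_add D(2))
        moreover have "f (w(i := w i)) \<le> f (w(i := s))" if "\<bar>w i - s\<bar> < d - \<bar>w i - z i\<bar>" for s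
        proof -
          have "w(i := s) \<in> cube z d" using w(1) that i by (auto simp: cube_def)
          then show ?thesis using w(2) by simp
        qed
        ultimately show ?thesis
          using DERIV_local_min[of "\<lambda>s. f (w(i := s))" _ "w i" "d - \<bar>w i - z i\<bar>"] lt by simp
      qed
      then show ?case using w(1) by blast
    qed
  qed
  have "\<forall>\<^sub>F \<epsilon> in at_right 0. \<epsilon> > 0 \<and> (\<forall>z\<in>Z. \<exists>w\<in>cube z d. \<forall>i\<in>I. D i w + 6 * \<epsilon> * w i ^ 5 = 0)"
    using Z crit by (simp add: eventually_conj_iff eventually_ball_finite_distrib eventually_at_right_less)
  then obtain \<epsilon> where "\<epsilon> > 0" "\<forall>z\<in>Z. \<exists>w\<in>cube z d. \<forall>i\<in>I. D i w + 6 * \<epsilon> * w i ^ 5 = 0"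
    using eventually_happens[of _ "at_right (0::real)"] by force
  then obtain W where W: "\<And>z. z \<in> Z \<Longrightarrow> W z \<in> cube z d"
    "\<And>z i. z \<in> Z \<Longrightarrow> i \<in> I \<Longrightarrow> D i (W z) + 6 * \<epsilon> * W z i ^ 5 = 0" by metis
  have "inj_on W Z"
  proof (rule inj_onI)
    fix y z assume yz: "y \<in> Z" "z \<in> Z" "W y = W z"
    have "\<bar>y i - z i\<bar> \<le> 2 * d" if "i \<in> I" for i
      using W(1)[OF yz(1)] W(1)[OF yz(2)] yz(3) that by (fastforce simp: cube_def abs_le_iff)
    then have "y \<in> cube z (e z)"
      using d(2)[OF yz(2)] supp[OF yz(1)] by (fastforce simp: cube_def)
    then show "y = z" using e(2) yz zero by blast
  qed
  moreover have "card (W ` Z) \<le> 5 ^ card I"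
  proof (rule card_zeros_pure_power_system[OF I])
    show "pdeg I 4 (\<lambda>w. - 1 / (6 * \<epsilon>) * D i w)" for i using D(1) by (rule pdeg_cmult)
    fix w i assume "w \<in> W ` Z" "i \<in> I"
    then have "D i w + 6 * \<epsilon> * w i ^ 5 = 0" using W(2) by blast
    then show "w i ^ 5 = - 1 / (6 * \<epsilon>) * D i w" using \<open>\<epsilon> > 0\<close> by (simp add: field_simps)
  next
    fix w i assume "w \<in> W ` Z" "i \<notin> I"
    then show "w i = 0" using W(1) by (auto simp: cube_def)
  qed (use Z in simp)
  ultimately show ?thesis by (simp add: card_image)
qed



section \<open>Paths of computation trees\<close>

lemma tendsto_nhds_continuous_on_UNIV: "continuous_on UNIV f \<Longrightarrow> (f \<longlongrightarrow> f z) (nhds z)"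
  by (simp add: continuous_on_def tendsto_at_iff_tendsto_nhds)

lemma pdeg_tendsto: "pdeg I d f \<Longrightarrow> (f \<longlongrightarrow> f z) (nhds z)"
  using pdeg_continuous tendsto_nhds_continuous_on_UNIV by blast

lemma coordinate_tendsto: "((\<lambda>w. w i) \<longlongrightarrow> z i) (nhds z)" for z :: "'i \<Rightarrow> real"
  using tendsto_nhds_continuous_on_UNIV continuous_on_product_coordinates by fast

text \<open>
  Along a path of the tree, \<open>w (Inl i)\<close> stands for the input \<open>i\<close> and \<open>w (Inr j)\<close> for the variable
  of the vertex at depth \<open>j\<close>.
\<close>

definition anc_vals :: "nat \<Rightarrow> (nat + nat \<Rightarrow> real) \<Rightarrow> real list"
  where "anc_vals k w = map (\<lambda>j. w (Inr j)) (rev [0..<k])"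

lemma anc_vals_Suc: "anc_vals (Suc k) w = w (Inr k) # anc_vals k w"
  by (simp add: anc_vals_def)

lemma anc_vals_cong: "(\<And>j. j < k \<Longrightarrow> w (Inr j) = z (Inr j)) \<Longrightarrow> anc_vals k w = anc_vals k z"
  by (simp add: anc_vals_def)

definition operand_poly :: "nat \<Rightarrow> operand \<Rightarrow> (nat + nat \<Rightarrow> real) \<Rightarrow> real"
  where "operand_poly k a w = operand_val (\<lambda>i. w (Inl i)) (anc_vals k w) a"

text \<open>Division is cleared of its denominator to stay polynomial. Where \<open>b = 0\<close>
  the equation no longer expresses the quotient, so it is usable only near points with nonzero
  \<open>b\<close>.\<close>

fun operation_poly :: "operation \<Rightarrow> real \<Rightarrow> real \<Rightarrow> real \<Rightarrow> real" where
  "operation_poly Add y a b = y - (a + b)"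
| "operation_poly Sub y a b = y - (a - b)"
| "operation_poly Mul y a b = y - a * b"
| "operation_poly Div y a b = y * b - a"

text \<open>
  Variables of depths that are not reached are set to zero, so that the systems of all leaves live
  in the same space.
\<close>

fun path_polys :: "nat \<Rightarrow> nat \<Rightarrow> act \<Rightarrow> ((nat + nat \<Rightarrow> real) \<Rightarrow> real) set" where
  "path_polys H k (Leaf b) = {\<lambda>w. \<Sum>j\<in>{k..<H}. (w (Inr j))\<^sup>2}"
| "path_polys H k (Compute f a b t) =
    (\<lambda>P w. (operation_poly f (w (Inr k)) (operand_poly k a w) (operand_poly k b w))\<^sup>2 + P w)
      ` path_polys H (Suc k) t"
| "path_polys H k (Branch a p z m) =
    (\<lambda>P w. (w (Inr k) - operand_poly k a w)\<^sup>2 + P w)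
      ` (path_polys H (Suc k) p \<union> (\<lambda>P w. (w (Inr k))\<^sup>2 + P w) ` path_polys H (Suc k) z
         \<union> path_polys H (Suc k) m)"

lemma path_polys_finite: "finite (path_polys H k t)"
  by (induction t arbitrary: k) auto

lemma path_polys_card: "card (path_polys H k t) \<le> 3 ^ act_height t"
proof (induction t arbitrary: k)
  case (Compute f a b t)
  have "card (path_polys H k (Compute f a b t)) \<le> card (path_polys H (Suc k) t)"
    by (simp add: card_image_le path_polys_finite)
  also have "\<dots> \<le> 3 ^ act_height t" by (rule Compute)
  finally show ?case by simp
next
  case (Branch a p z m)
  let ?A = "path_polys H (Suc k)"
  let ?h = "max (act_height p) (max (act_height z) (act_height m))"
  let ?g = "\<lambda>P w. (w (Inr k))\<^sup>2 + P w"
  have le: "card (?A p) \<le> 3 ^ ?h" "card (?A z) \<le> 3 ^ ?h" "card (?A m) \<le> 3 ^ ?h"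
    using Branch[of "Suc k"] by (auto intro: order_trans power_increasing)
  have "card (path_polys H k (Branch a p z m)) \<le> card (?A p \<union> ?g ` ?A z \<union> ?A m)"
    by (simp add: card_image_le path_polys_finite)
  also have "\<dots> \<le> card (?A p) + card (?g ` ?A z) + card (?A m)"
    using card_Un_le[of "?A p \<union> ?g ` ?A z" "?A m"] card_Un_le[of "?A p" "?g ` ?A z"] by linarith
  also have "\<dots> \<le> 3 ^ ?h + 3 ^ ?h + 3 ^ ?h"
    using le card_image_le[OF path_polys_finite, of ?g H "Suc k" z] by linarith
  finally show ?case by simp
qed simp

lemma path_polys_nonneg: "P \<in> path_polys H k t \<Longrightarrow> P w \<ge> 0"
  by (induction t arbitrary: k P) (auto intro!: sum_nonneg add_nonneg_nonneg)

lemma operand_poly_pdeg: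
  assumes "wf_operand n k a" "k \<le> H"
  shows "pdeg ({..<n} <+> {..<H}) 1 (operand_poly k a)"
proof (cases a)
  case (Const c)
  then show ?thesis by (simp add: operand_poly_def [abs_def] pdeg.const)
next
  case (Input i)
  then show ?thesis using assms pdeg_coord[of "Inl i" "{..<n} <+> {..<H}" 0]
    by (simp add: operand_poly_def [abs_def] InlI)
next
  case (Pred j)
  \<comment> \<open>The list starts with the nearest ancestor, so \<open>Pred j\<close> refers to
    depth \<open>k - Suc j\<close>.\<close>
  then have "anc_vals k w ! j = w (Inr (k - Suc j))" for w
    using assms by (simp add: anc_vals_def rev_nth)
  then show ?thesis using Pred assms pdeg_coord[of "Inr (k - Suc j)" "{..<n} <+> {..<H}" 0]
    by (simp add: operand_poly_def [abs_def] InrI)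
qed

lemma operation_poly_pdeg:
  assumes "pdeg I 1 y" "pdeg I 1 a" "pdeg I 1 b"
  shows "pdeg I 2 (\<lambda>w. operation_poly f (y w) (a w) (b w))"
proof -
  have y: "pdeg I 2 y" and a: "pdeg I 2 a" and b: "pdeg I 2 b"
    using assms by (auto elim: pdeg_mono)
  have ab: "pdeg I 2 (\<lambda>w. a w * b w)" and yb: "pdeg I 2 (\<lambda>w. y w * b w)"
    using pdeg_mult[OF assms(2,3)] pdeg_mult[OF assms(1,3)] by (simp_all add: numeral_2_eq_2)
  show ?thesis
    by (cases f) (simp_all add: pdeg_diff pdeg.add y a b ab yb)
qed

lemma path_polys_pdeg:
  assumes "wf_act n k t" "k + act_height t \<le> H" "P \<in> path_polys H k t"
  shows "pdeg ({..<n} <+> {..<H}) 4 P"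
  using assms
proof (induction t arbitrary: k P)
  let ?I = "{..<n} <+> {..<H}"
  have vars: "pdeg ?I 1 (\<lambda>w. w (Inr j))" if "j < H" for j
    using that pdeg_coord[of "Inr j" ?I 0] by (simp add: InrI)
  have sq: "pdeg ?I 4 (\<lambda>w. (f w)\<^sup>2)" if "pdeg ?I 2 f" for f
    using pdeg_power2[OF that] by simp
  {
    case (Leaf b)
    then show ?case by (auto intro!: pdeg_sum sq pdeg_mono[OF vars])
  next
    case (Compute f a b t)
    then show ?case
      by (auto intro!: pdeg.add sq operation_poly_pdeg vars operand_poly_pdeg)
  next
    case (Branch a p z m)
    have *: "pdeg ?I 4 (\<lambda>w. (w (Inr k) - operand_poly k a w)\<^sup>2)" "pdeg ?I 4 (\<lambda>w. (w (Inr k))\<^sup>2)"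
      using Branch.prems
      by (auto intro!: sq pdeg_mono[of ?I 1 _ 2] pdeg_diff vars operand_poly_pdeg)
    from Branch show ?case by (auto intro!: pdeg.add *)
  }
qed

lemma operation_poly_zero_iff:
  assumes "f = Div \<Longrightarrow> b \<noteq> 0"
  shows "operation_poly f y a b = 0 \<longleftrightarrow> apply_operation f a b = Some y"
  using assms by (cases f) (auto simp: field_simps)

text \<open>The witness \<open>z\<close> extends the given values by those computed on the run.
  Besides acceptance of nearby zeros, the conclusion says that inputs and ancestor values determine
  the remaining variables: otherwise a zero with isolated input could still move in the auxiliary
  variables.\<close>

lemma accepting_run_path_poly:
  assumes "wf_act n k t" "k + act_height t \<le> H"
    "run (\<lambda>i. z0 (Inl i)) (anc_vals k z0) t = Some True"
  shows "\<exists>P\<in>path_polys H k t. \<exists>z. (\<forall>i. z (Inl i) = z0 (Inl i)) \<and> (\<forall>j<k. z (Inr j) = z0 (Inr j))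
    \<and> (\<forall>j\<ge>H. z (Inr j) = 0) \<and> P z = 0
    \<and> (\<forall>\<^sub>F w in nhds z. P w = 0 \<longrightarrow>
        run (\<lambda>i. w (Inl i)) (anc_vals k w) t = Some True \<and>
        ((\<forall>i. w (Inl i) = z (Inl i)) \<longrightarrow> (\<forall>j<k. w (Inr j) = z (Inr j))
          \<longrightarrow> (\<forall>j<H. w (Inr j) = z (Inr j))))"
  using assms
proof (induction t arbitrary: k z0)
  case (Leaf b)
  define z where "z v = (case v of Inl i \<Rightarrow> z0 (Inl i) | Inr j \<Rightarrow> if j < k then z0 (Inr j) else 0)" for v
  let ?P = "\<lambda>w :: nat + nat \<Rightarrow> real. \<Sum>j\<in>{k..<H}. (w (Inr j))\<^sup>2"
  have "w (Inr j) = z (Inr j)" if "?P w = 0" "\<forall>j<k. w (Inr j) = z (Inr j)" "j < H" for w j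
  proof (cases "j < k")
    case False
    then have "w (Inr j) = 0" using that by (simp add: sum_nonneg_eq_0_iff)
    then show ?thesis using False by (simp add: z_def)
  qed (use that in simp)
  then show ?case using Leaf
    by (intro bexI[of _ ?P] exI[of _ z]) (auto simp: z_def intro!: always_eventually)
next
  case (Compute f a b t)
  let ?a = "operand_poly k a" and ?b = "operand_poly k b"
  from Compute.prems obtain y where y: "apply_operation f (?a z0) (?b z0) = Some y"
    "run (\<lambda>i. z0 (Inl i)) (y # anc_vals k z0) t = Some True"
    by (auto simp: operand_poly_def split: option.splits)
  \<comment> \<open>The subtree sees the current vertex as one more ancestor, so its value joins the
    given data.\<close>
  define z1 where "z1 = z0(Inr k := y)"
  have z1: "(\<lambda>i. z1 (Inl i)) = (\<lambda>i. z0 (Inl i))" "anc_vals (Suc k) z1 = y # anc_vals k z0"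
    by (auto simp: z1_def anc_vals_Suc intro: anc_vals_cong)
  have "\<exists>P\<in>path_polys H (Suc k) t. \<exists>z. (\<forall>i. z (Inl i) = z1 (Inl i))
    \<and> (\<forall>j<Suc k. z (Inr j) = z1 (Inr j)) \<and> (\<forall>j\<ge>H. z (Inr j) = 0) \<and> P z = 0
    \<and> (\<forall>\<^sub>F w in nhds z. P w = 0 \<longrightarrow>
        run (\<lambda>i. w (Inl i)) (anc_vals (Suc k) w) t = Some True \<and>
        ((\<forall>i. w (Inl i) = z (Inl i)) \<longrightarrow> (\<forall>j<Suc k. w (Inr j) = z (Inr j))
          \<longrightarrow> (\<forall>j<H. w (Inr j) = z (Inr j))))"
    using Compute.IH[of "Suc k" z1] Compute.prems(1,2) y(2) unfolding z1 by simp
  then obtain P z where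
    P: "P \<in> path_polys H (Suc k) t" and
    z: "\<And>i. z (Inl i) = z1 (Inl i)" "\<And>j. j < Suc k \<Longrightarrow> z (Inr j) = z1 (Inr j)"
      "\<And>j. j \<ge> H \<Longrightarrow> z (Inr j) = 0" "P z = 0" and
    ev: "\<forall>\<^sub>F w in nhds z. P w = 0 \<longrightarrow>
        run (\<lambda>i. w (Inl i)) (anc_vals (Suc k) w) t = Some True \<and>
        ((\<forall>i. w (Inl i) = z (Inl i)) \<longrightarrow> (\<forall>j<Suc k. w (Inr j) = z (Inr j))
          \<longrightarrow> (\<forall>j<H. w (Inr j) = z (Inr j)))"
    by blast
  have zk: "z (Inr k) = y" "\<And>j. j < k \<Longrightarrow> z (Inr j) = z0 (Inr j)" "\<And>i. z (Inl i) = z0 (Inl i)"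
    using z(1,2) by (auto simp: z1_def)
  have cong: "operand_poly k c w = operand_poly k c z"
    if "\<forall>i. w (Inl i) = z (Inl i)" "\<forall>j<k. w (Inr j) = z (Inr j)" for w c
    using that anc_vals_cong[of k w z] by (simp add: operand_poly_def)
  have ab: "?a z = ?a z0" "?b z = ?b z0"
    using cong[of z0] zk by auto
  have app: "apply_operation f (?a z) (?b z) = Some (z (Inr k))"
    using y(1) ab zk(1) by simp
  let ?Q = "\<lambda>w. (operation_poly f (w (Inr k)) (?a w) (?b w))\<^sup>2 + P w"
  have Q0: "?Q w = 0 \<longleftrightarrow> operation_poly f (w (Inr k)) (?a w) (?b w) = 0 \<and> P w = 0" for w
    using path_polys_nonneg[OF P, of w] by (simp add: add_nonneg_eq_0_iff)
  have div: "f = Div \<Longrightarrow> ?b z \<noteq> 0" using app by (auto split: if_splits)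
  \<comment> \<open>The denominator is continuous in the variables and nonzero at \<open>z\<close>,
    hence nonzero nearby.\<close>
  have bev: "\<forall>\<^sub>F w in nhds z. f = Div \<longrightarrow> ?b w \<noteq> 0"
  proof (cases "f = Div")
    case True
    have "(?b \<longlongrightarrow> ?b z) (nhds z)"
      using Compute.prems(1,2) by (intro pdeg_tendsto[OF operand_poly_pdeg[of n k b H]]) auto
    then show ?thesis using div[OF True] by (auto elim: eventually_mono dest: tendsto_imp_eventually_ne)
  qed simp
  from bev ev have "\<forall>\<^sub>F w in nhds z. ?Q w = 0 \<longrightarrow>
        run (\<lambda>i. w (Inl i)) (anc_vals k w) (Compute f a b t) = Some True \<and>
        ((\<forall>i. w (Inl i) = z (Inl i)) \<longrightarrow> (\<forall>j<k. w (Inr j) = z (Inr j))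
          \<longrightarrow> (\<forall>j<H. w (Inr j) = z (Inr j)))"
  proof eventually_elim
    case (elim w)
    show ?case
    proof (intro impI)
      assume "?Q w = 0"
      then have Pw: "P w = 0" and appw: "apply_operation f (?a w) (?b w) = Some (w (Inr k))"
        using operation_poly_zero_iff[of f "?b w"] elim(1) by (auto simp: Q0)
      have "run (\<lambda>i. w (Inl i)) (anc_vals k w) (Compute f a b t) = Some True"
        using appw elim(2) Pw by (simp add: operand_poly_def anc_vals_Suc)
      moreover have "\<forall>j<H. w (Inr j) = z (Inr j)"
        if "\<forall>i. w (Inl i) = z (Inl i)" "\<forall>j<k. w (Inr j) = z (Inr j)"
      proof -
        have "w (Inr k) = z (Inr k)" using appw app cong[OF that] by simp
        then have "\<forall>j<Suc k. w (Inr j) = z (Inr j)" using that(2) by (simp add: less_Suc_eq)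
        then show ?thesis using elim(2) Pw that(1) by blast
      qed
      ultimately show "run (\<lambda>i. w (Inl i)) (anc_vals k w) (Compute f a b t) = Some True \<and>
        ((\<forall>i. w (Inl i) = z (Inl i)) \<longrightarrow> (\<forall>j<k. w (Inr j) = z (Inr j))
          \<longrightarrow> (\<forall>j<H. w (Inr j) = z (Inr j)))" by blast
    qed
  qed
  moreover have "?Q z = 0" using Q0 z(4) operation_poly_zero_iff[OF div] app by blast
  moreover have "?Q \<in> path_polys H k (Compute f a b t)" using P by auto
  ultimately show ?case using zk z(3) by (intro bexI[of _ ?Q] exI[of _ z]) auto
next
  case (Branch a p m0 m)
  let ?a = "operand_poly k a"
  define y where "y = ?a z0"
  define t where "t = (if y > 0 then p else if y = 0 then m0 else m)"
  have t: "wf_act n (Suc k) t" "Suc k + act_height t \<le> H"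
    "run (\<lambda>i. z0 (Inl i)) (y # anc_vals k z0) t = Some True"
    using Branch.prems by (auto simp: t_def y_def operand_poly_def Let_def split: if_splits)
  define z1 where "z1 = z0(Inr k := y)"
  have z1: "(\<lambda>i. z1 (Inl i)) = (\<lambda>i. z0 (Inl i))" "anc_vals (Suc k) z1 = y # anc_vals k z0"
    by (auto simp: z1_def anc_vals_Suc intro: anc_vals_cong)
  have "\<exists>P\<in>path_polys H (Suc k) t. \<exists>z. (\<forall>i. z (Inl i) = z1 (Inl i))
    \<and> (\<forall>j<Suc k. z (Inr j) = z1 (Inr j)) \<and> (\<forall>j\<ge>H. z (Inr j) = 0) \<and> P z = 0
    \<and> (\<forall>\<^sub>F w in nhds z. P w = 0 \<longrightarrow>
        run (\<lambda>i. w (Inl i)) (anc_vals (Suc k) w) t = Some True \<and>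
        ((\<forall>i. w (Inl i) = z (Inl i)) \<longrightarrow> (\<forall>j<Suc k. w (Inr j) = z (Inr j))
          \<longrightarrow> (\<forall>j<H. w (Inr j) = z (Inr j))))"
    using Branch.IH(1)[of "Suc k" z1] Branch.IH(2)[of "Suc k" z1] Branch.IH(3)[of "Suc k" z1] t
    unfolding z1 t_def by (auto split: if_splits)
  then obtain P z where
    P: "P \<in> path_polys H (Suc k) t" and
    z: "\<And>i. z (Inl i) = z1 (Inl i)" "\<And>j. j < Suc k \<Longrightarrow> z (Inr j) = z1 (Inr j)"
      "\<And>j. j \<ge> H \<Longrightarrow> z (Inr j) = 0" "P z = 0" and
    ev: "\<forall>\<^sub>F w in nhds z. P w = 0 \<longrightarrow>
        run (\<lambda>i. w (Inl i)) (anc_vals (Suc k) w) t = Some True \<and>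
        ((\<forall>i. w (Inl i) = z (Inl i)) \<longrightarrow> (\<forall>j<Suc k. w (Inr j) = z (Inr j))
          \<longrightarrow> (\<forall>j<H. w (Inr j) = z (Inr j)))"
    by blast
  have zk: "z (Inr k) = y" "\<And>j. j < k \<Longrightarrow> z (Inr j) = z0 (Inr j)" "\<And>i. z (Inl i) = z0 (Inl i)"
    using z(1,2) by (auto simp: z1_def)
  have cong: "operand_poly k c w = operand_poly k c z"
    if "\<forall>i. w (Inl i) = z (Inl i)" "\<forall>j<k. w (Inr j) = z (Inr j)" for w c
    using that anc_vals_cong[of k w z] by (simp add: operand_poly_def)
  have az: "?a z = y"
    using cong[of z0] zk by (auto simp: y_def)
  \<comment> \<open>Unlike the strict signs, the value 0 does not persist under small changes, so
    the zero branch needs its own equation.\<close>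
  define P' where "P' = (if y = 0 then (\<lambda>w. (w (Inr k))\<^sup>2 + P w) else P)"
  let ?Q = "\<lambda>w. (w (Inr k) - ?a w)\<^sup>2 + P' w"
  have P'0: "P' w = 0 \<longleftrightarrow> P w = 0 \<and> (y = 0 \<longrightarrow> w (Inr k) = 0)" "P' w \<ge> 0" for w
    using path_polys_nonneg[OF P, of w] by (auto simp: add_nonneg_eq_0_iff P'_def)
  have Q0: "?Q w = 0 \<longleftrightarrow> w (Inr k) = ?a w \<and> P w = 0 \<and> (y = 0 \<longrightarrow> w (Inr k) = 0)" for w
    using P'0[of w] by (auto simp: add_nonneg_eq_0_iff)
  have lim: "((\<lambda>w. w (Inr k)) \<longlongrightarrow> y) (nhds z)"
    using coordinate_tendsto[of "Inr k" z] zk(1) by simp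
  have sev: "\<forall>\<^sub>F w in nhds z. (y > 0 \<longrightarrow> w (Inr k) > 0) \<and> (y < 0 \<longrightarrow> w (Inr k) < 0)"
    using order_tendstoD[OF lim, of 0]
    by (cases "y > 0"; cases "y < 0") (auto elim: eventually_mono)
  from sev ev have "\<forall>\<^sub>F w in nhds z. ?Q w = 0 \<longrightarrow>
        run (\<lambda>i. w (Inl i)) (anc_vals k w) (Branch a p m0 m) = Some True \<and>
        ((\<forall>i. w (Inl i) = z (Inl i)) \<longrightarrow> (\<forall>j<k. w (Inr j) = z (Inr j))
          \<longrightarrow> (\<forall>j<H. w (Inr j) = z (Inr j)))"
  proof eventually_elim
    case (elim w)
    show ?case
    proof (intro impI)
      assume "?Q w = 0"
      then have Pw: "P w = 0" and wk: "w (Inr k) = ?a w" "y = 0 \<longrightarrow> w (Inr k) = 0"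
        by (auto simp: Q0)
      have "run (\<lambda>i. w (Inl i)) (w (Inr k) # anc_vals k w) t = Some True"
        using elim(2) Pw by (simp add: anc_vals_Suc)
      then have "run (\<lambda>i. w (Inl i)) (anc_vals k w) (Branch a p m0 m) = Some True"
        using wk elim(1) by (auto simp: t_def operand_poly_def Let_def split: if_splits)
      moreover have "\<forall>j<H. w (Inr j) = z (Inr j)"
        if "\<forall>i. w (Inl i) = z (Inl i)" "\<forall>j<k. w (Inr j) = z (Inr j)"
      proof -
        have "w (Inr k) = z (Inr k)" using wk(1) az zk(1) cong[OF that] by simp
        then have "\<forall>j<Suc k. w (Inr j) = z (Inr j)" using that(2) by (simp add: less_Suc_eq)
        then show ?thesis using elim(2) Pw that(1) by blast
      qed
      ultimately show "run (\<lambda>i. w (Inl i)) (anc_vals k w) (Branch a p m0 m) = Some True \<and>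
        ((\<forall>i. w (Inl i) = z (Inl i)) \<longrightarrow> (\<forall>j<k. w (Inr j) = z (Inr j))
          \<longrightarrow> (\<forall>j<H. w (Inr j) = z (Inr j)))" by blast
    qed
  qed
  moreover have "?Q z = 0" using P'0(1)[of z] z(4) az zk(1) by simp
  moreover have "?Q \<in> path_polys H k (Branch a p m0 m)"
    using P by (auto simp: t_def P'_def split: if_splits)
  ultimately show ?case using zk z(3) by (intro bexI[of _ ?Q] exI[of _ z]) auto
qed



section \<open>Double points\<close>

lemma Euclidean_space_eq: "Euclidean_space n = top_of_set (Rn n)"
  unfolding topspace_Euclidean_space by (simp add: Euclidean_space_def euclidean_product_topology)

lemma tendsto_fun_iff:
  fixes X :: "'a \<Rightarrow> 'i \<Rightarrow> real"
  shows "(X \<longlongrightarrow> x) F \<longleftrightarrow> (\<forall>i. ((\<lambda>a. X a i) \<longlongrightarrow> x i) F)"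
  using limitin_componentwise[of "\<lambda>_::'i. euclideanreal" UNIV X x F]
  by (simp add: euclidean_product_topology)

lemma embedding_map_inverse:
  assumes "embedding_map (top_of_set A) (Euclidean_space n) f"
  obtains h where "continuous_on (f ` A) h" "\<And>a. a \<in> A \<Longrightarrow> h (f a) = a"
proof -
  obtain h where h: "homeomorphic_maps (top_of_set A) (subtopology (Euclidean_space n) (f ` A)) f h"
    using assms by (auto simp: embedding_map_def homeomorphic_map_maps)
  then have "f ` A \<subseteq> Rn n"
    by (auto simp: homeomorphic_maps_def continuous_map_def)
  then have "subtopology (Euclidean_space n) (f ` A) = top_of_set (f ` A)"
    by (subst Euclidean_space_eq) (simp add: subtopology_subtopology Int_absorb1)
  with h have "continuous_on (f ` A) h" "\<And>a. a \<in> A \<Longrightarrow> h (f a) = a"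
    by (auto simp: homeomorphic_maps_def)
  then show ?thesis using that by blast
qed

text \<open>Caratheodory's difference quotient of \<open>g\<close>, composed with
  \<open>\<sigma>\<close>. Only a right inverse of \<open>g\<close> that is continuous at
  \<open>x\<close> is required, so for the circle a local choice of angle suffices.\<close>

lemma secant_of_parametrization:
  assumes g: "smooth_immersed_path n I g" and "\<sigma> x \<in> I"
    and \<sigma>: "continuous (at x within S) \<sigma>" "\<And>y. y \<in> S \<Longrightarrow> g (\<sigma> y) = y" and x: "x \<in> S"
  shows "\<exists>\<tau> q w k. (\<forall>y\<in>S. \<forall>i<n. y i - x i = \<tau> y * q i y)
    \<and> (\<forall>i<n. continuous (at x within S) (q i) \<and> q i x = w i) \<and> k < n \<and> w k \<noteq> (0::real)"
proof -
  define w where "w = velocity n g (\<sigma> x)"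
  have "((\<lambda>s. g s i) has_real_derivative w i) (at (\<sigma> x))" if "i < n" for i
  proof -
    have "(deriv ^^ 0) (\<lambda>s. g s i) differentiable (at (\<sigma> x))"
      using g assms(2) that unfolding smooth_immersed_path_def smooth_path_def by blast
    then show ?thesis using that
      by (simp add: w_def velocity_def DERIV_deriv_iff_real_differentiable)
  qed
  then have "\<forall>i. \<exists>Q. i < n \<longrightarrow> (\<forall>s. g s i - g (\<sigma> x) i = Q s * (s - \<sigma> x)) \<and> isCont Q (\<sigma> x) \<and> Q (\<sigma> x) = w i"
    by (auto simp: CARAT_DERIV)
  then obtain Q where Q: "\<And>i s. i < n \<Longrightarrow> g s i - g (\<sigma> x) i = Q i s * (s - \<sigma> x)"
    "\<And>i. i < n \<Longrightarrow> isCont (Q i) (\<sigma> x)" "\<And>i. i < n \<Longrightarrow> Q i (\<sigma> x) = w i" by metis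
  have "w \<noteq> (\<lambda>i. 0)" using g assms(2) by (auto simp: smooth_immersed_path_def w_def)
  then obtain k where k: "w k \<noteq> 0" by auto
  moreover from k have "k < n" by (auto simp: w_def velocity_def split: if_splits)
  moreover have "continuous (at x within S) (\<lambda>y. Q i (\<sigma> y))" if "i < n" for i
    by (rule continuous_within_compose3[OF Q(2)[OF that] \<sigma>(1)])
  moreover have "y i - x i = (\<sigma> y - \<sigma> x) * Q i (\<sigma> y)" if "y \<in> S" "i < n" for y i
    using Q(1)[OF that(2), of "\<sigma> y"] \<sigma>(2) that x by (simp add: mult.commute)
  ultimately show ?thesis
    using Q(3) by (intro exI[of _ "\<lambda>y. \<sigma> y - \<sigma> x"] exI[of _ "\<lambda>i y. Q i (\<sigma> y)"]
        exI[of _ w] exI[of _ k]) simp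
qed

text \<open>
  Caratheodory's form of differentiability at \<open>x\<close>: the chords of the curve from \<open>x\<close> are multiples
  of vectors \<open>q y\<close> that depend continuously on the endpoint \<open>y\<close> and tend to the tangent \<open>w\<close>.
\<close>

lemma curve_secant:
  assumes "smooth_circle n S \<or> smooth_arc n S" and x: "x \<in> S"
  obtains \<tau> q w k where
    "\<And>y i. y \<in> S \<Longrightarrow> i < n \<Longrightarrow> y i - x i = \<tau> y * q i y"
    "\<And>i. i < n \<Longrightarrow> continuous (at x within S) (q i)"
    "\<And>i. i < n \<Longrightarrow> q i x = w i" "k < n" "w k \<noteq> (0::real)"
proof -
  have "\<exists>\<tau> q w k. (\<forall>y\<in>S. \<forall>i<n. y i - x i = \<tau> y * q i y)
    \<and> (\<forall>i<n. continuous (at x within S) (q i) \<and> q i x = w i) \<and> k < n \<and> w k \<noteq> (0::real)"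
    using assms(1)
  proof
    assume "smooth_arc n S"
    then obtain g where g: "embedding_map (top_of_set {0<..<1}) (Euclidean_space n) g"
      "smooth_immersed_path n {0<..<1} g" "S = g ` {0<..<1}" by (auto simp: smooth_arc_def)
    obtain h where h: "continuous_on S h" "\<And>a. a \<in> {0<..<1} \<Longrightarrow> h (g a) = a"
      using embedding_map_inverse[OF g(1)] g(3) by blast
    show ?thesis
    proof (rule secant_of_parametrization[OF g(2) _ _ _ x])
      show "h x \<in> {0<..<1}" using x g(3) h(2) by auto
      show "continuous (at x within S) h" using h(1) x by (simp add: continuous_on_eq_continuous_within)
      show "g (h y) = y" if "y \<in> S" for y using that g(3) h(2) by force
    qed
  next
    assume "smooth_circle n S"
    then obtain f where f: "embedding_map (top_of_set (sphere (0::complex) 1)) (Euclidean_space n) f"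
      "smooth_immersed_path n UNIV (\<lambda>t. f (cis t))" "S = f ` sphere 0 1"
      by (auto simp: smooth_circle_def)
    obtain h where h: "continuous_on S h" "\<And>a. a \<in> sphere 0 1 \<Longrightarrow> h (f a) = a"
      using embedding_map_inverse[OF f(1)] f(3) by blast
    have norm_h: "norm (h y) = 1" and fh: "f (h y) = y" if "y \<in> S" for y
      using that f(3) h(2) by force+
    have cis: "cis (Arg z) = z" if "norm z = 1" for z
      using that by (subst cis_Arg) (auto simp: sgn_div_norm)
    show ?thesis
    \<comment> \<open>The principal argument jumps on the negative real axis. Measuring the angle
      relative to \<open>h x\<close> moves the point of interest to 1, where \<open>Arg\<close> is
      continuous.\<close>
    proof (rule secant_of_parametrization[OF f(2) _ _ _ x, of "\<lambda>y. Arg (h x) + Arg (h y / h x)"])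
      show "Arg (h x) + Arg (h x / h x) \<in> UNIV" by simp
      have "h x \<noteq> 0" using norm_h[OF x] by auto
      then have "(h \<longlongrightarrow> h x) (at x within S)" "isCont Arg (h x / h x)"
        using h(1) x by (auto simp: continuous_on_def intro: continuous_at_Arg)
      then have "((\<lambda>y. Arg (h y / h x)) \<longlongrightarrow> Arg (h x / h x)) (at x within S)"
        using \<open>h x \<noteq> 0\<close> by (intro isCont_tendsto_compose[of _ Arg] tendsto_intros)
      then show "continuous (at x within S) (\<lambda>y. Arg (h x) + Arg (h y / h x))"
        unfolding continuous_within by (rule tendsto_add[OF tendsto_const])
      show "f (cis (Arg (h x) + Arg (h y / h x))) = y" if "y \<in> S" for y
      proof -
        have "cis (Arg (h x) + Arg (h y / h x)) = h x * (h y / h x)"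
          using norm_h[OF x] norm_h[OF that] by (simp add: cis norm_divide flip: cis_mult)
        then show ?thesis using \<open>h x \<noteq> 0\<close> fh[OF that] by simp
      qed
    qed
  qed
  then obtain \<tau> q w k where "\<forall>y\<in>S. \<forall>i<n. y i - x i = \<tau> y * q i y"
    "\<forall>i<n. continuous (at x within S) (q i) \<and> q i x = w i" "k < n" "w k \<noteq> (0::real)"
    by blast
  then show ?thesis by (intro that[of \<tau> q w k]) auto
qed

text \<open>Double points are defined with arbitrary paths in \<open>S\<close>, while isolation is
  proved with chords. The factor \<open>l\<close> is the limit of
  \<open>\<tau> (g t) / t\<close>.\<close>

lemma tangent_vector_parallel:
  assumes secant: "\<And>y i. y \<in> S \<Longrightarrow> i < n \<Longrightarrow> y i - x i = \<tau> y * q i y"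
    and cont: "\<And>i. i < n \<Longrightarrow> continuous (at x within S) (q i)"
    and qx: "\<And>i. i < n \<Longrightarrow> q i x = w i" and k: "k < n" "w k \<noteq> (0::real)"
    and u: "tangent_vector n S x u"
  obtains l where "\<And>i. i < n \<Longrightarrow> u i = l * w i"
proof -
  obtain g where g: "smooth_path n {-1<..<1} g" "g ` {-1<..<1} \<subseteq> S" "g 0 = x" "velocity n g 0 = u"
    using u by (auto simp: tangent_vector_def)
  have der: "((\<lambda>s. g s i) has_real_derivative u i) (at 0)" if "i < n" for i
  proof -
    have "0 \<in> {-1<..<1::real}" by simp
    then have "(deriv ^^ 0) (\<lambda>s. g s i) differentiable (at 0)"
      using g(1) that unfolding smooth_path_def by blast
    then show ?thesis using that g(4)
      by (auto simp: velocity_def DERIV_deriv_iff_real_differentiable)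
  qed
  have I: "\<forall>\<^sub>F t in at 0. t \<in> {-1<..<1::real}"
    by (rule eventually_at_in_open') auto
  have S: "\<forall>\<^sub>F t in at 0. g t \<in> S" using I by eventually_elim (use g(2) in blast)
  have "((\<lambda>t. g t i) \<longlongrightarrow> x i) (at 0)" for i
  proof (cases "i < n")
    case True
    then show ?thesis using DERIV_isCont[OF der[OF True]] g(3) by (simp add: isCont_def)
  next
    case False
    \<comment> \<open>Convergence in the function type concerns all coordinates, also those from
      \<open>n\<close> on.\<close>
    have "g t i = 0" if "t \<in> {-1<..<1}" for t
      using g(1) False that by (force simp: smooth_path_def topspace_Euclidean_space)
    from this[of 0] this have "x i = 0" "\<forall>\<^sub>F t in at 0. g t i = 0"
      using I g(3) by (auto elim: eventually_mono)
    then show ?thesis using tendsto_eventually[of "\<lambda>t. g t i"] by metis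
  qed
  then have gx: "(g \<longlongrightarrow> x) (at 0)" by (simp add: tendsto_fun_iff)
  have q: "((\<lambda>t. q i (g t)) \<longlongrightarrow> w i) (at 0)" if "i < n" for i
    using continuous_within_tendsto_compose[OF cont[OF that] S gx] qx[OF that] by simp
  have quot: "((\<lambda>t. \<tau> (g t) * q i (g t) / t) \<longlongrightarrow> u i) (at 0)" if "i < n" for i
  proof -
    have "((\<lambda>t. (g t i - x i) / t) \<longlongrightarrow> u i) (at 0)"
      using der[OF that] g(3) by (simp add: DERIV_def)
    moreover have "\<forall>\<^sub>F t in at 0. (g t i - x i) / t = \<tau> (g t) * q i (g t) / t"
      using S by eventually_elim (simp add: secant that)
    ultimately show ?thesis by (rule Lim_transform_eventually)
  qed
  \<comment> \<open>Coordinate \<open>k\<close> of the chord direction has nonzero limit, so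
    dividing by it isolates the scalar \<open>\<tau> (g t) / t\<close>.\<close>
  have "((\<lambda>t. (\<tau> (g t) * q k (g t) / t) / q k (g t)) \<longlongrightarrow> u k / w k) (at 0)"
    using quot q k by (intro tendsto_intros) auto
  moreover have "\<forall>\<^sub>F t in at 0. q k (g t) \<noteq> 0"
    using q[OF k(1)] k(2) by (rule tendsto_imp_eventually_ne)
  then have "\<forall>\<^sub>F t in at 0. (\<tau> (g t) * q k (g t) / t) / q k (g t) = \<tau> (g t) / t"
    by eventually_elim simp
  ultimately have \<tau>: "((\<lambda>t. \<tau> (g t) / t) \<longlongrightarrow> u k / w k) (at 0)"
    by (rule Lim_transform_eventually)
  have "u i = u k / w k * w i" if "i < n" for i
  proof -
    have "((\<lambda>t. \<tau> (g t) / t * q i (g t)) \<longlongrightarrow> u k / w k * w i) (at 0)"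
      by (rule tendsto_mult[OF \<tau> q[OF that]])
    then have "((\<lambda>t. \<tau> (g t) * q i (g t) / t) \<longlongrightarrow> u k / w k * w i) (at 0)" by simp
    then show ?thesis using quot[OF that] by (intro tendsto_unique) auto
  qed
  then show ?thesis using that by blast
qed

section \<open>Orthogonal projection in coordinates\<close>

lemma dot_lincomb: "dot n (\<lambda>i. a * x i + b * y i) z = a * dot n x z + b * dot n y z"
  by (simp add: dot_def sum_distrib_left sum.distrib algebra_simps)

lemma dot_diff: "dot n (\<lambda>i. x i - y i) z = dot n x z - dot n y z"
  by (simp add: dot_def sum_subtractf left_diff_distrib)

lemma dot_commute: "dot n x y = dot n y x"
  by (simp add: dot_def mult.commute)

lemma dot_scale: "(\<And>i. i < n \<Longrightarrow> x i = c * y i) \<Longrightarrow> dot n x z = c * dot n y z"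
  by (simp add: dot_def sum_distrib_left mult.assoc)

lemma dot_self_eq_0:
  assumes "dot n x x = 0" "x \<in> Rn n"
  shows "x = (\<lambda>i. 0)"
proof
  show "x i = 0" for i
    using assms by (cases "i < n") (auto simp: dot_def sum_nonneg_eq_0_iff topspace_Euclidean_space)
qed

text \<open>Strict Cauchy-Schwarz: the squared length of \<open>?z\<close> is
  \<open>dot n u u\<close> times the determinant, so a vanishing determinant would give a linear
  relation.\<close>

lemma gram_det_nonzero:
  assumes "independent2 u v" "u \<in> Rn n" "v \<in> Rn n"
  shows "dot n u u * dot n v v - dot n u v * dot n u v \<noteq> 0"
proof
  let ?A = "dot n u u" and ?B = "dot n u v"
  let ?z = "\<lambda>i. ?B * u i + (- ?A) * v i"
  assume D: "dot n u u * dot n v v - dot n u v * dot n u v = 0"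
  have "dot n ?z ?z = ?B * (?B * ?A - ?A * ?B) + - ?A * (?B * ?B - ?A * dot n v v)"
    unfolding dot_lincomb dot_commute[of n _ ?z] by (simp add: dot_commute)
  also have "\<dots> = 0" using D by (simp add: algebra_simps)
  finally have "?z = (\<lambda>i. 0)"
    by (rule dot_self_eq_0) (use assms in \<open>simp add: topspace_Euclidean_space\<close>)
  then have "?A = 0" using assms(1) unfolding independent2_def by (metis neg_equal_0_iff_equal)
  then have "u = (\<lambda>i. 0)" using assms dot_self_eq_0 by blast
  then have "(\<lambda>i. 1 * u i + 0 * v i) = (\<lambda>i. 0)" by simp
  then show False using assms(1) unfolding independent2_def by (metis zero_neq_one)
qed

lemma cramer_symmetric:
  fixes A B C s t :: real
  defines "D \<equiv> A * C - B * B"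
  assumes "D \<noteq> 0"
  shows "(C * s - B * t) / D * A + (A * t - B * s) / D * B = s"
    and "(C * s - B * t) / D * B + (A * t - B * s) / D * C = t"
proof -
  have "(C * s - B * t) * A + (A * t - B * s) * B = s * D"
    "(C * s - B * t) * B + (A * t - B * s) * C = t * D" by (simp_all add: D_def algebra_simps)
  then show "(C * s - B * t) / D * A + (A * t - B * s) / D * B = s"
    "(C * s - B * t) / D * B + (A * t - B * s) / D * C = t"
    using \<open>D \<noteq> 0\<close> by (simp_all flip: add_divide_distrib)
qed

text \<open>Orthogonality to \<open>L\<close> amounts to orthogonality to \<open>u\<close> and
  \<open>v\<close>. These normal equations have the Gram matrix as coefficients and are solved by
  Cramer's rule.\<close>

lemma proj_eq:
  assumes "independent2 u v" "u \<in> Rn n" "v \<in> Rn n"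
    and L: "L = {(\<lambda>i. a * u i + b * v i) | a b. True}"
  defines "D \<equiv> dot n u u * dot n v v - dot n u v * dot n u v"
  shows "proj n L x = (\<lambda>i. (dot n v v * dot n x u - dot n u v * dot n x v) / D * u i
    + (dot n u u * dot n x v - dot n u v * dot n x u) / D * v i)"
  unfolding proj_def
proof (rule the_equality)
  have D: "D \<noteq> 0" unfolding D_def using gram_det_nonzero assms by blast
  have vu: "dot n v u = dot n u v" by (rule dot_commute)
  have orth: "(\<forall>z\<in>L. dot n y z = 0) \<longleftrightarrow> dot n y u = 0 \<and> dot n y v = 0" for y
  proof
    assume *: "\<forall>z\<in>L. dot n y z = 0"
    have "u \<in> L" unfolding L by (rule CollectI, rule exI[of _ 1], rule exI[of _ 0]) simp
    moreover have "v \<in> L" unfolding L by (rule CollectI, rule exI[of _ 0], rule exI[of _ 1]) simp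
    ultimately show "dot n y u = 0 \<and> dot n y v = 0" using * by blast
  next
    assume "dot n y u = 0 \<and> dot n y v = 0"
    then show "\<forall>z\<in>L. dot n y z = 0"
      by (auto simp: L dot_commute[of n y] dot_lincomb)
  qed
  let ?a = "(dot n v v * dot n x u - dot n u v * dot n x v) / D"
  let ?b = "(dot n u u * dot n x v - dot n u v * dot n x u) / D"
  let ?y = "\<lambda>i. ?a * u i + ?b * v i"
  have ab: "?a * dot n u u + ?b * dot n u v = dot n x u"
    "?a * dot n u v + ?b * dot n v v = dot n x v"
    using D unfolding D_def by (rule cramer_symmetric)+
  have "?y \<in> L" unfolding L by blast
  moreover have "\<forall>z\<in>L. dot n (\<lambda>i. x i - ?y i) z = 0"
    unfolding orth unfolding dot_diff dot_lincomb vu ab by simp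
  ultimately show "?y \<in> L \<and> (\<forall>z\<in>L. dot n (\<lambda>i. x i - ?y i) z = 0)" by blast
  fix y assume y: "y \<in> L \<and> (\<forall>z\<in>L. dot n (\<lambda>i. x i - y i) z = 0)"
  then obtain a b where ab: "y = (\<lambda>i. a * u i + b * v i)" by (auto simp: L)
  have xu: "dot n x u = a * dot n u u + b * dot n u v" and xv: "dot n x v = a * dot n u v + b * dot n v v"
    using y unfolding orth by (auto simp: ab dot_diff dot_lincomb vu)
  have "dot n v v * dot n x u - dot n u v * dot n x v = a * D"
    "dot n u u * dot n x v - dot n u v * dot n x u = b * D"
    unfolding xu xv D_def by (simp_all add: algebra_simps)
  then show "y = ?y" using D by (simp add: ab)
qed

text \<open>This makes coincidence of projections two linear equations, which can join the system of
  the tree.\<close>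

lemma proj_eq_iff:
  assumes "independent2 u v" "u \<in> Rn n" "v \<in> Rn n"
    and L: "L = {(\<lambda>i. a * u i + b * v i) | a b. True}"
  shows "proj n L x = proj n L y \<longleftrightarrow> dot n x u = dot n y u \<and> dot n x v = dot n y v"
proof
  assume "dot n x u = dot n y u \<and> dot n x v = dot n y v"
  then show "proj n L x = proj n L y" unfolding proj_eq[OF assms] by simp
next
  have vu: "dot n v u = dot n u v" by (rule dot_commute)
  have "dot n (proj n L x) u = dot n x u" "dot n (proj n L x) v = dot n x v" for x
    unfolding proj_eq[OF assms] dot_lincomb vu
    by (rule cramer_symmetric[OF gram_det_nonzero[OF assms(1-3)]])+
  then show "proj n L x = proj n L y \<Longrightarrow> dot n x u = dot n y u \<and> dot n x v = dot n y v"
    by metis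
qed

lemma independent2_proj_det:
  assumes uv: "independent2 u v" "u \<in> Rn n" "v \<in> Rn n"
    "L = {(\<lambda>i. a * u i + b * v i) | a b. True}"
    and ind: "independent2 (proj n L x) (proj n L y)"
  shows "dot n x u * dot n y v - dot n x v * dot n y u \<noteq> 0"
proof
  assume det: "dot n x u * dot n y v - dot n x v * dot n y u = 0"
  have *: "a = 0 \<and> b = 0"
    if "a * dot n x u + b * dot n y u = 0" "a * dot n x v + b * dot n y v = 0" for a b
  proof -
    have "(\<lambda>i. a * proj n L x i + b * proj n L y i) = proj n L (\<lambda>i. a * x i + b * y i)"
      unfolding proj_eq[OF uv] dot_lincomb by (simp add: algebra_simps add_divide_distrib diff_divide_distrib)
    also have "\<dots> = (\<lambda>i. 0)"
      unfolding proj_eq[OF uv] dot_lincomb that by simp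
    finally show ?thesis using ind unfolding independent2_def by blast
  qed
  \<comment> \<open>If the determinant vanishes, \<open>(dot n y u, - dot n x u)\<close> and
    \<open>(dot n y v, - dot n x v)\<close> are coefficients of linear relations between the
    projections.\<close>
  have "dot n y u = 0 \<and> - dot n x u = 0" "dot n y v = 0 \<and> - dot n x v = 0"
    using det by (intro *; simp add: algebra_simps)+
  then show False using *[of 1 0] by simp
qed

section \<open>Isolation of transversal pairs\<close>

text \<open>Along the chords, equal projections become a homogeneous 2 by 2 system for
  \<open>\<tau>\<close> and \<open>\<tau>'\<close> whose determinant tends to \<open>det\<close>.
  The filter \<open>F\<close> is arbitrary so that the pair may be part of a larger point.\<close>

lemma transversal_pair_isolated:
  assumes S: "S \<subseteq> Rn n"
    and x: "\<And>z i. z \<in> S \<Longrightarrow> i < n \<Longrightarrow> z i - x i = \<tau> z * q i z"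
      "\<And>i. i < n \<Longrightarrow> continuous (at x within S) (q i)" "\<And>i. i < n \<Longrightarrow> q i x = w i" "x \<in> S"
    and y: "\<And>z i. z \<in> S \<Longrightarrow> i < n \<Longrightarrow> z i - y i = \<tau>' z * q' i z"
      "\<And>i. i < n \<Longrightarrow> continuous (at y within S) (q' i)" "\<And>i. i < n \<Longrightarrow> q' i y = w' i" "y \<in> S"
    and det: "dot n w u * dot n w' v - dot n w v * dot n w' u \<noteq> (0::real)"
    and xy: "dot n x u = dot n y u" "dot n x v = dot n y v"
    and X: "(X \<longlongrightarrow> x) F" and Y: "(Y \<longlongrightarrow> y) F" and ev: "\<forall>\<^sub>F a in F. X a \<in> S \<and> Y a \<in> S"
  shows "\<forall>\<^sub>F a in F. dot n (X a) u = dot n (Y a) u \<and> dot n (X a) v = dot n (Y a) v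
    \<longrightarrow> X a = x \<and> Y a = y"
proof -
  define p where "p z a = dot n (\<lambda>i. q i z) a" for z a
  define p' where "p' z a = dot n (\<lambda>i. q' i z) a" for z a
  have ev': "\<forall>\<^sub>F a in F. X a \<in> S" "\<forall>\<^sub>F a in F. Y a \<in> S" using ev by (auto elim: eventually_mono)
  have "((\<lambda>a. q i (X a)) \<longlongrightarrow> w i) F" "((\<lambda>a. q' i (Y a)) \<longlongrightarrow> w' i) F" if "i < n" for i
    using continuous_within_tendsto_compose[OF x(2) ev'(1) X] x(3)
      continuous_within_tendsto_compose[OF y(2) ev'(2) Y] y(3) that by auto
  then have lim: "((\<lambda>a. p (X a) b) \<longlongrightarrow> dot n w b) F" "((\<lambda>a. p' (Y a) b) \<longlongrightarrow> dot n w' b) F" for b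
    unfolding p_def p'_def dot_def by (auto intro!: tendsto_intros)
  have "((\<lambda>a. p (X a) u * p' (Y a) v - p (X a) v * p' (Y a) u) \<longlongrightarrow>
      dot n w u * dot n w' v - dot n w v * dot n w' u) F"
    by (intro tendsto_intros lim)
  then have "\<forall>\<^sub>F a in F. p (X a) u * p' (Y a) v - p (X a) v * p' (Y a) u \<noteq> 0"
    using det by (rule tendsto_imp_eventually_ne)
  with ev show ?thesis
  proof eventually_elim
    case (elim a)
    let ?x = "X a" and ?y = "Y a"
    have p: "dot n ?x b = dot n x b + \<tau> ?x * p ?x b" for b
      using dot_scale[of n "\<lambda>i. ?x i - x i" "\<tau> ?x" "\<lambda>i. q i ?x" b] x(1) elim(1)
      by (simp add: dot_diff p_def)
    have p': "dot n ?y b = dot n y b + \<tau>' ?y * p' ?y b" for b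
      using dot_scale[of n "\<lambda>i. ?y i - y i" "\<tau>' ?y" "\<lambda>i. q' i ?y" b] y(1) elim(1)
      by (simp add: dot_diff p'_def)
    show ?case
    proof
      assume "dot n ?x u = dot n ?y u \<and> dot n ?x v = dot n ?y v"
      then have eq: "\<tau> ?x * p ?x u = \<tau>' ?y * p' ?y u" "\<tau> ?x * p ?x v = \<tau>' ?y * p' ?y v"
        using xy by (auto simp: p p')
      let ?d = "p ?x u * p' ?y v - p ?x v * p' ?y u"
      have "\<tau> ?x * ?d = (\<tau> ?x * p ?x u) * p' ?y v - (\<tau> ?x * p ?x v) * p' ?y u"
        by (simp add: algebra_simps)
      also have "\<dots> = 0" unfolding eq by (simp add: algebra_simps)
      finally have \<tau>0: "\<tau> ?x = 0" using elim(2) by simp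
      have "\<tau>' ?y * ?d = (\<tau>' ?y * p' ?y v) * p ?x u - (\<tau>' ?y * p' ?y u) * p ?x v"
        by (simp add: algebra_simps)
      also have "\<dots> = 0" unfolding eq[symmetric] by (simp add: algebra_simps)
      finally have \<tau>'0: "\<tau>' ?y = 0" using elim(2) by simp
      have out: "z i = 0" if "z \<in> S" "\<not> i < n" for z i
        using S that by (auto simp: topspace_Euclidean_space)
      have "?x i = x i" for i
        using x(1)[of ?x i] elim(1) \<tau>0 out[of ?x i] out[of x i] x(4) by (cases "i < n") simp_all
      moreover have "?y i = y i" for i
        using y(1)[of ?y i] elim(1) \<tau>'0 out[of ?y i] out[of y i] y(4) by (cases "i < n") simp_all
      ultimately show "?x = x \<and> ?y = y" by blast
    qed
  qed
qed

lemma smooth_curve_subset_Rn: "smooth_circle n S \<or> smooth_arc n S \<Longrightarrow> S \<subseteq> Rn n"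
proof (elim disjE)
  assume "smooth_circle n S"
  then obtain f where f: "smooth_immersed_path n UNIV (\<lambda>t. f (cis t))" "S = f ` sphere 0 1"
    by (auto simp: smooth_circle_def)
  show ?thesis
  proof
    fix y assume "y \<in> S"
    then obtain z where z: "norm z = 1" "y = f z" using f(2) by auto
    then have "cis (Arg z) = z" by (subst cis_Arg) (auto simp: sgn_div_norm)
    then have "y = f (cis (Arg z))" using z by simp
    then show "y \<in> Rn n" using f(1) by (auto simp: smooth_immersed_path_def smooth_path_def)
  qed
qed (auto simp: smooth_arc_def smooth_immersed_path_def smooth_path_def)

text \<open>The given tangent vectors are multiples of the chord limits \<open>w\<close> and
  \<open>w'\<close>, so their nonzero determinant passes to these.\<close>

lemma double_point_isolated:
  assumes curve: "smooth_circle n S \<or> smooth_arc n S"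
    and uv: "independent2 u v" "u \<in> Rn n" "v \<in> Rn n"
      "L = {(\<lambda>i. a * u i + b * v i) | a b. True}"
    and q: "double_point n S L q"
  obtains x y where "x \<in> S" "y \<in> S" "proj n L x = q" "dot n x u = dot n y u" "dot n x v = dot n y v"
    "\<And>X Y (F :: 'a filter). (X \<longlongrightarrow> x) F \<Longrightarrow> (Y \<longlongrightarrow> y) F \<Longrightarrow> \<forall>\<^sub>F a in F. X a \<in> S \<and> Y a \<in> S \<Longrightarrow>
      \<forall>\<^sub>F a in F. dot n (X a) u = dot n (Y a) u \<and> dot n (X a) v = dot n (Y a) v
        \<longrightarrow> X a = x \<and> Y a = y"
proof -
  obtain x y a b where xy: "{z \<in> S. proj n L z = q} = {x, y}" and
    a: "tangent_vector n S x a" and b: "tangent_vector n S y b" and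
    ab: "independent2 (proj n L a) (proj n L b)"
    using q unfolding double_point_def by (elim exE conjE) (rule that)
  have x: "x \<in> S" "proj n L x = q" and y: "y \<in> S" "proj n L y = q" using xy by auto
  have dots: "dot n x u = dot n y u" "dot n x v = dot n y v"
    using proj_eq_iff[OF uv, of x y] x y by auto
  obtain \<tau> q w k where X: "\<And>z i. z \<in> S \<Longrightarrow> i < n \<Longrightarrow> z i - x i = \<tau> z * q i z"
    "\<And>i. i < n \<Longrightarrow> continuous (at x within S) (q i)"
    "\<And>i. i < n \<Longrightarrow> q i x = w i" "k < n" "w k \<noteq> (0::real)"
    using curve_secant[OF curve x(1)] by blast
  obtain \<tau>' q' w' k' where Y: "\<And>z i. z \<in> S \<Longrightarrow> i < n \<Longrightarrow> z i - y i = \<tau>' z * q' i z"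
    "\<And>i. i < n \<Longrightarrow> continuous (at y within S) (q' i)"
    "\<And>i. i < n \<Longrightarrow> q' i y = w' i" "k' < n" "w' k' \<noteq> (0::real)"
    using curve_secant[OF curve y(1)] by blast
  obtain l where l: "\<And>i. i < n \<Longrightarrow> a i = l * w i"
    using tangent_vector_parallel[OF X a] by blast
  obtain l' where l': "\<And>i. i < n \<Longrightarrow> b i = l' * w' i"
    using tangent_vector_parallel[OF Y b] by blast
  have "dot n a u * dot n b v - dot n a v * dot n b u \<noteq> 0"
    by (rule independent2_proj_det[OF uv ab])
  also have "dot n a u * dot n b v - dot n a v * dot n b u
      = l * l' * (dot n w u * dot n w' v - dot n w v * dot n w' u)"
    using dot_scale[of n a l w] l dot_scale[of n b l' w'] l' by (simp add: algebra_simps)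
  finally have det: "dot n w u * dot n w' v - dot n w v * dot n w' u \<noteq> 0" by simp
  show ?thesis
    by (rule that[OF x(1) y(1) x(2) dots])
      (rule transversal_pair_isolated[OF smooth_curve_subset_Rn[OF curve] X(1-3) x(1) Y(1-3) y(1) det dots])
qed



section \<open>Counting double points\<close>

text \<open>The case of the root. The tree reads only inputs below \<open>n\<close>, so vanishing of
  the others is demanded separately to land in \<open>Rn n\<close>.\<close>

lemma tested_point_path_poly:
  assumes "wf_act n 0 t" "tests_membership n t S" "x \<in> S"
  defines "H \<equiv> act_height t"
  obtains P z where "P \<in> path_polys H 0 t" "\<And>i. z (Inl i) = x i" "\<And>j. j \<ge> H \<Longrightarrow> z (Inr j) = 0"
    "P z = 0"
    "\<forall>\<^sub>F w in nhds z. P w = 0 \<longrightarrow> (\<forall>i\<ge>n. w (Inl i) = 0) \<longrightarrow> (\<lambda>i. w (Inl i)) \<in> S \<and>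
      ((\<lambda>i. w (Inl i)) = x \<longrightarrow> (\<forall>j<H. w (Inr j) = z (Inr j)))"
proof -
  have S: "S = {x \<in> Rn n. run x [] t = Some True}" using assms(2) by (simp add: tests_membership_def)
  define z0 :: "nat + nat \<Rightarrow> real" where "z0 = case_sum x (\<lambda>_. 0)"
  have "run (\<lambda>i. z0 (Inl i)) (anc_vals 0 z0) t = Some True"
    using assms(3) by (simp add: S z0_def anc_vals_def)
  then obtain P z where P: "P \<in> path_polys H 0 t" and z: "\<forall>i. z (Inl i) = z0 (Inl i)"
    "\<forall>j\<ge>H. z (Inr j) = 0" "P z = 0" and
    ev: "\<forall>\<^sub>F w in nhds z. P w = 0 \<longrightarrow>
        run (\<lambda>i. w (Inl i)) (anc_vals 0 w) t = Some True \<and>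
        ((\<forall>i. w (Inl i) = z (Inl i)) \<longrightarrow> (\<forall>j<0. w (Inr j) = z (Inr j))
          \<longrightarrow> (\<forall>j<H. w (Inr j) = z (Inr j)))"
    using accepting_run_path_poly[OF assms(1), of H z0] unfolding H_def by auto
  have zx: "z (Inl i) = x i" for i using z(1) by (simp add: z0_def)
  from ev have "\<forall>\<^sub>F w in nhds z. P w = 0 \<longrightarrow> (\<forall>i\<ge>n. w (Inl i) = 0) \<longrightarrow> (\<lambda>i. w (Inl i)) \<in> S \<and>
      ((\<lambda>i. w (Inl i)) = x \<longrightarrow> (\<forall>j<H. w (Inr j) = z (Inr j)))"
    by eventually_elim (auto simp: S topspace_Euclidean_space anc_vals_def zx)
  then show ?thesis using that[OF P zx _ z(3)] z(2) by blast
qed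

text \<open>The boolean tags two copies of the path variables, \<open>False\<close> for the first
  point of the pair and \<open>True\<close> for the second. The two copies may follow different
  paths.\<close>

definition crossing_poly ::
  "nat \<Rightarrow> (nat \<Rightarrow> real) \<Rightarrow> (nat \<Rightarrow> real) \<Rightarrow> ((nat + nat \<Rightarrow> real) \<Rightarrow> real) \<Rightarrow> ((nat + nat \<Rightarrow> real) \<Rightarrow> real)
    \<Rightarrow> (bool \<times> (nat + nat) \<Rightarrow> real) \<Rightarrow> real"
  where "crossing_poly n u v P P' w = P (\<lambda>i. w (False, i)) + P' (\<lambda>i. w (True, i))
    + (\<Sum>b\<leftarrow>[u, v]. (dot n (\<lambda>i. w (False, Inl i)) b - dot n (\<lambda>i. w (True, Inl i)) b)\<^sup>2)"

lemma crossing_poly_pdeg: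
  assumes "pdeg ({..<n} <+> {..<H}) 4 P" "pdeg ({..<n} <+> {..<H}) 4 P'"
  shows "pdeg (UNIV \<times> ({..<n} <+> {..<H})) 4 (crossing_poly n u v P P')"
proof -
  let ?J = "(UNIV :: bool set) \<times> ({..<n} <+> {..<H :: nat})"
  have P: "pdeg ?J 4 (\<lambda>w. P (\<lambda>i. w (False, i)))" "pdeg ?J 4 (\<lambda>w. P' (\<lambda>i. w (True, i)))"
    using assms by (auto intro: pdeg_reindex)
  have coord: "pdeg ?J 1 (\<lambda>w. w (c, Inl i) * b i)" if "i < n" for c b i
    using pdeg.coord_mult[of "(c, Inl i)" ?J 0 "\<lambda>w. b i"] that by (auto intro: pdeg.const)
  have "pdeg ?J 2 (\<lambda>w. (dot n (\<lambda>i. w (False, Inl i)) b - dot n (\<lambda>i. w (True, Inl i)) b)\<^sup>2)" for b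
    using coord unfolding dot_def
    by (intro pdeg_power2[where d = 1, simplified] pdeg_diff pdeg_sum) auto
  then have "pdeg ?J 4 (\<lambda>w. (dot n (\<lambda>i. w (False, Inl i)) b - dot n (\<lambda>i. w (True, Inl i)) b)\<^sup>2)" for b
    by (rule pdeg_mono) simp
  then show ?thesis unfolding crossing_poly_def [abs_def] by (auto intro!: pdeg.intros P)
qed

lemma crossing_poly_nonneg:
  assumes "\<And>w. P w \<ge> 0" "\<And>w. P' w \<ge> 0"
  shows "crossing_poly n u v P P' w \<ge> 0"
  using assms by (simp add: crossing_poly_def)

lemma crossing_poly_eq_0_iff:
  assumes "\<And>w. P w \<ge> 0" "\<And>w. P' w \<ge> 0"
  shows "crossing_poly n u v P P' w = 0 \<longleftrightarrow> P (\<lambda>i. w (False, i)) = 0 \<and> P' (\<lambda>i. w (True, i)) = 0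
    \<and> dot n (\<lambda>i. w (False, Inl i)) u = dot n (\<lambda>i. w (True, Inl i)) u
    \<and> dot n (\<lambda>i. w (False, Inl i)) v = dot n (\<lambda>i. w (True, Inl i)) v"
proof -
  have *: "a + b + (c\<^sup>2 + d\<^sup>2) = 0 \<longleftrightarrow> a = 0 \<and> b = 0 \<and> c = 0 \<and> d = 0" if "a \<ge> 0" "b \<ge> 0" for a b c d :: real
    using that by (auto simp: add_nonneg_eq_0_iff)
  show ?thesis by (simp add: crossing_poly_def * assms)
qed

text \<open>Nearby zeros have accepted inputs, hence points of the curve; transversality then fixes
  both inputs, and the inputs fix the values computed from them.\<close>

lemma double_point_isolated_zero:
  assumes curve: "smooth_circle n S \<or> smooth_arc n S"
    and uv: "independent2 u v" "u \<in> Rn n" "v \<in> Rn n"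
      "L = {(\<lambda>i. a * u i + b * v i) | a b. True}"
    and q: "double_point n S L q"
    and t: "wf_act n 0 t" "tests_membership n t S"
  defines "H \<equiv> act_height t"
  shows "\<exists>P\<in>path_polys H 0 t. \<exists>P'\<in>path_polys H 0 t. \<exists>z. proj n L (\<lambda>i. z (False, Inl i)) = q
    \<and> (\<forall>i. i \<notin> UNIV \<times> ({..<n} <+> {..<H}) \<longrightarrow> z i = 0) \<and> crossing_poly n u v P P' z = 0
    \<and> (\<forall>\<^sub>F w in nhds z. (\<forall>i. i \<notin> UNIV \<times> ({..<n} <+> {..<H}) \<longrightarrow> w i = 0) \<longrightarrow>
        crossing_poly n u v P P' w = 0 \<longrightarrow> w = z)"
proof -
  obtain x y where xy: "x \<in> S" "y \<in> S" "proj n L x = q" "dot n x u = dot n y u" "dot n x v = dot n y v" and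
    iso: "\<And>X Y (F :: (bool \<times> (nat + nat) \<Rightarrow> real) filter).
      (X \<longlongrightarrow> x) F \<Longrightarrow> (Y \<longlongrightarrow> y) F \<Longrightarrow> \<forall>\<^sub>F a in F. X a \<in> S \<and> Y a \<in> S \<Longrightarrow>
      \<forall>\<^sub>F a in F. dot n (X a) u = dot n (Y a) u \<and> dot n (X a) v = dot n (Y a) v
        \<longrightarrow> X a = x \<and> Y a = y"
    using double_point_isolated[OF curve uv q] by blast
  obtain P z1 where P: "P \<in> path_polys H 0 t" and z1: "\<And>i. z1 (Inl i) = x i"
    "\<And>j. j \<ge> H \<Longrightarrow> z1 (Inr j) = 0" "P z1 = 0" and
    ev1: "\<forall>\<^sub>F w in nhds z1. P w = 0 \<longrightarrow> (\<forall>i\<ge>n. w (Inl i) = 0) \<longrightarrow> (\<lambda>i. w (Inl i)) \<in> S \<and>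
      ((\<lambda>i. w (Inl i)) = x \<longrightarrow> (\<forall>j<H. w (Inr j) = z1 (Inr j)))"
    using tested_point_path_poly[OF t xy(1)] unfolding H_def by blast
  obtain P' z2 where P': "P' \<in> path_polys H 0 t" and z2: "\<And>i. z2 (Inl i) = y i"
    "\<And>j. j \<ge> H \<Longrightarrow> z2 (Inr j) = 0" "P' z2 = 0" and
    ev2: "\<forall>\<^sub>F w in nhds z2. P' w = 0 \<longrightarrow> (\<forall>i\<ge>n. w (Inl i) = 0) \<longrightarrow> (\<lambda>i. w (Inl i)) \<in> S \<and>
      ((\<lambda>i. w (Inl i)) = y \<longrightarrow> (\<forall>j<H. w (Inr j) = z2 (Inr j)))"
    using tested_point_path_poly[OF t xy(2)] unfolding H_def by blast
  define z where "z = (\<lambda>(c, i). if c then z2 i else z1 i)"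
  have z: "(\<lambda>i. z (False, i)) = z1" "(\<lambda>i. z (True, i)) = z2" by (simp_all add: z_def)
  have zI: "(\<lambda>i. z (False, Inl i)) = x" "(\<lambda>i. z (True, Inl i)) = y" by (simp_all add: z_def z1 z2)
  let ?I = "{..<n} <+> {..<H}"
  let ?supp = "\<lambda>w :: bool \<times> (nat + nat) \<Rightarrow> real. \<forall>i. i \<notin> UNIV \<times> ?I \<longrightarrow> w i = 0"
  let ?Q = "crossing_poly n u v P P'"
  have nonneg: "\<And>w. P w \<ge> 0" "\<And>w. P' w \<ge> 0" using path_polys_nonneg P P' by auto
  have Q0: "?Q w = 0 \<longleftrightarrow> P (\<lambda>i. w (False, i)) = 0 \<and> P' (\<lambda>i. w (True, i)) = 0
    \<and> dot n (\<lambda>i. w (False, Inl i)) u = dot n (\<lambda>i. w (True, Inl i)) u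
    \<and> dot n (\<lambda>i. w (False, Inl i)) v = dot n (\<lambda>i. w (True, Inl i)) v" for w
    by (rule crossing_poly_eq_0_iff[OF nonneg])
  have "x \<in> Rn n" "y \<in> Rn n" using xy smooth_curve_subset_Rn[OF curve] by auto
  then have zsupp: "?supp z"
    using z1 z2 by (auto simp: z_def topspace_Euclidean_space Plus_def image_iff not_less split: sum.splits)
      (metis InlI InrI lessThan_iff not_less obj_sumE)+
  \<comment> \<open>Isolation of \<open>z\<close> is the statement that \<open>w = z\<close> holds
    eventually along this filter.\<close>
  define F where "F = inf (nhds z) (principal {w. ?Q w = 0 \<and> ?supp w})"
  have F: "F \<le> nhds z" by (simp add: F_def)
  have inF: "\<forall>\<^sub>F w in F. ?Q w = 0 \<and> ?supp w"
    by (simp add: F_def eventually_inf_principal)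
  have lim: "((\<lambda>w i. w (h i)) \<longlongrightarrow> (\<lambda>i. z (h i))) F" for h :: "'b \<Rightarrow> bool \<times> (nat + nat)"
    unfolding tendsto_fun_iff using tendsto_mono[OF F coordinate_tendsto] by blast
  have ev1': "\<forall>\<^sub>F w in F. P (\<lambda>i. w (False, i)) = 0 \<longrightarrow> (\<forall>i\<ge>n. w (False, Inl i) = 0) \<longrightarrow>
      (\<lambda>i. w (False, Inl i)) \<in> S \<and>
      ((\<lambda>i. w (False, Inl i)) = x \<longrightarrow> (\<forall>j<H. w (False, Inr j) = z1 (Inr j)))"
    using filterlim_iff[THEN iffD1, OF lim[of "Pair False"], rule_format] ev1 unfolding z by blast
  have ev2': "\<forall>\<^sub>F w in F. P' (\<lambda>i. w (True, i)) = 0 \<longrightarrow> (\<forall>i\<ge>n. w (True, Inl i) = 0) \<longrightarrow>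
      (\<lambda>i. w (True, Inl i)) \<in> S \<and>
      ((\<lambda>i. w (True, Inl i)) = y \<longrightarrow> (\<forall>j<H. w (True, Inr j) = z2 (Inr j)))"
    using filterlim_iff[THEN iffD1, OF lim[of "Pair True"], rule_format] ev2 unfolding z by blast
  have limX: "((\<lambda>w i. w (False, Inl i)) \<longlongrightarrow> x) F" and limY: "((\<lambda>w i. w (True, Inl i)) \<longlongrightarrow> y) F"
    using lim[of "\<lambda>i. (False, Inl i)"] lim[of "\<lambda>i. (True, Inl i)"] by (simp_all add: zI)
  have supp_Inl: "w (c, Inl i) = 0" if "?supp w" "i \<ge> n" for w c i
    by (rule that(1)[rule_format]) (use that(2) in auto)
  have supp_Inr: "w (c, Inr j) = 0" if "?supp w" "j \<ge> H" for w c j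
    by (rule that(1)[rule_format]) (use that(2) in auto)
  \<comment> \<open>Transversality speaks only of points of the curve, so membership in
    \<open>S\<close> has to come before it.\<close>
  from inF ev1' ev2' have "\<forall>\<^sub>F w in F. (\<lambda>i. w (False, Inl i)) \<in> S \<and> (\<lambda>i. w (True, Inl i)) \<in> S"
    by eventually_elim (use supp_Inl Q0 in blast)
  from iso[OF limX limY this] inF ev1' ev2' have "\<forall>\<^sub>F w in F. w = z"
  proof eventually_elim
    case (elim w)
    then have P0: "P (\<lambda>i. w (False, i)) = 0" "P' (\<lambda>i. w (True, i)) = 0" and
      wxy: "(\<lambda>i. w (False, Inl i)) = x" "(\<lambda>i. w (True, Inl i)) = y"
      using Q0 by blast+
    have r: "w (False, Inr j) = z1 (Inr j)" "w (True, Inr j) = z2 (Inr j)" for j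
      using elim(2-4) P0 wxy supp_Inl[of w] supp_Inr[of w j] z1(2)[of j] z2(2)[of j]
      by (cases "j < H"; simp)+
    have l: "w (False, Inl i) = x i" "w (True, Inl i) = y i" for i
      using wxy by metis+
    have "w (c, s) = z (c, s)" for c s
      using r l z1 z2 by (cases c; cases s) (simp_all add: z_def)
    then show ?case by auto
  qed
  then have "\<forall>\<^sub>F w in nhds z. ?supp w \<longrightarrow> ?Q w = 0 \<longrightarrow> w = z"
    unfolding F_def eventually_inf_principal by (auto elim: eventually_mono)
  moreover have "?Q z = 0" unfolding Q0 z zI using z1 z2 xy by simp
  moreover have "proj n L (\<lambda>i. z (False, Inl i)) = q" using zI xy(3) by simp
  ultimately show ?thesis
    by (intro bexI[OF _ P] bexI[OF _ P'] exI[of _ z] conjI zsupp)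
qed

text \<open>A double point is the projection of the first input of its zero, so within one pair of
  path polynomials distinct double points have distinct zeros. There are at most
  \<open>9 ^ H\<close> pairs with at most \<open>25 ^ (n + H)\<close> zeros each, and
  \<open>9 * 25 = 225\<close>.\<close>

lemma card_double_points_le:
  assumes curve: "smooth_circle n S \<or> smooth_arc n S" and L: "plane2 n L"
    and t: "wf_act n 0 t" "tests_membership n t S"
    and D: "finite D" "\<And>q. q \<in> D \<Longrightarrow> double_point n S L q"
  shows "card D \<le> 225 ^ act_height t * 25 ^ n"
proof -
  obtain u v where uv: "independent2 u v" "u \<in> Rn n" "v \<in> Rn n"
      "L = {(\<lambda>i. a * u i + b * v i) | a b. True}"
    using L by (auto simp: plane2_def)
  define H where "H = act_height t"
  let ?J = "(UNIV :: bool set) \<times> ({..<n} <+> {..<H})"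
  let ?A = "path_polys H 0 t"
  have "\<forall>q. \<exists>P P' z. q \<in> D \<longrightarrow> P \<in> ?A \<and> P' \<in> ?A \<and> proj n L (\<lambda>i. z (False, Inl i)) = q
    \<and> (\<forall>i. i \<notin> ?J \<longrightarrow> z i = 0) \<and> crossing_poly n u v P P' z = 0
    \<and> (\<forall>\<^sub>F w in nhds z. (\<forall>i. i \<notin> ?J \<longrightarrow> w i = 0) \<longrightarrow> crossing_poly n u v P P' w = 0 \<longrightarrow> w = z)"
    using double_point_isolated_zero[OF curve uv D(2) t] unfolding H_def Bex_def by blast
  then obtain P P' z where all: "\<forall>q. q \<in> D \<longrightarrow> P q \<in> ?A \<and> P' q \<in> ?A
    \<and> proj n L (\<lambda>i. z q (False, Inl i)) = q
    \<and> (\<forall>i. i \<notin> ?J \<longrightarrow> z q i = 0) \<and> crossing_poly n u v (P q) (P' q) (z q) = 0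
    \<and> (\<forall>\<^sub>F w in nhds (z q). (\<forall>i. i \<notin> ?J \<longrightarrow> w i = 0) \<longrightarrow>
        crossing_poly n u v (P q) (P' q) w = 0 \<longrightarrow> w = z q)"
    unfolding choice_iff by (elim exE) (rule that)
  have P: "P q \<in> ?A" "P' q \<in> ?A" and
    z: "proj n L (\<lambda>i. z q (False, Inl i)) = q" "\<And>i. i \<notin> ?J \<Longrightarrow> z q i = 0"
      "crossing_poly n u v (P q) (P' q) (z q) = 0"
      "\<forall>\<^sub>F w in nhds (z q). (\<forall>i. i \<notin> ?J \<longrightarrow> w i = 0) \<longrightarrow>
        crossing_poly n u v (P q) (P' q) w = 0 \<longrightarrow> w = z q" if "q \<in> D" for q
    using all that by blast+
  have fibre: "card {q \<in> D. P q = A \<and> P' q = B} \<le> 25 ^ (n + H)" if AB: "A \<in> ?A" "B \<in> ?A" for A B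
  proof -
    let ?D = "{q \<in> D. P q = A \<and> P' q = B}"
    have "inj_on z ?D"
    proof (rule inj_onI)
      fix q r assume qr: "q \<in> ?D" "r \<in> ?D" "z q = z r"
      have "q = proj n L (\<lambda>i. z q (False, Inl i))" by (rule z(1)[symmetric]) (use qr in blast)
      also have "\<dots> = proj n L (\<lambda>i. z r (False, Inl i))" by (simp only: qr(3))
      also have "\<dots> = r" by (rule z(1)) (use qr in blast)
      finally show "q = r" .
    qed
    then have "card ?D = card (z ` ?D)" by (simp add: card_image)
    also have "\<dots> \<le> 5 ^ card ?J"
    proof (rule card_isolated_zeros_le)
      show "pdeg ?J 4 (crossing_poly n u v A B)"
        using AB path_polys_pdeg[OF t(1), of H] by (intro crossing_poly_pdeg) (auto simp: H_def)
      show "crossing_poly n u v A B w \<ge> 0" for w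
        using AB path_polys_nonneg by (intro crossing_poly_nonneg) auto
      show "finite (z ` ?D)" using D(1) by simp
    qed (use z in auto)
    also have "card ?J = 2 * (n + H)" by (simp add: card_cartesian_product card_Plus)
    also have "5 ^ (2 * (n + H)) = (25::nat) ^ (n + H)" unfolding power_mult by simp
    finally show ?thesis .
  qed
  have "D = (\<Union>(A, B)\<in>?A \<times> ?A. {q \<in> D. P q = A \<and> P' q = B})" using P by auto
  then have "card D \<le> (\<Sum>(A, B)\<in>?A \<times> ?A. card {q \<in> D. P q = A \<and> P' q = B})"
    using card_UN_le[of "?A \<times> ?A" "\<lambda>(A, B). {q \<in> D. P q = A \<and> P' q = B}"] path_polys_finite
    by (simp add: case_prod_unfold)
  also have "\<dots> \<le> card (?A \<times> ?A) * 25 ^ (n + H)"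
    using sum_bounded_above[of "?A \<times> ?A" "\<lambda>(A, B). card {q \<in> D. P q = A \<and> P' q = B}" "25 ^ (n + H)"]
      fibre by auto
  also have "\<dots> \<le> 3 ^ H * 3 ^ H * 25 ^ (n + H)"
    unfolding card_cartesian_product using path_polys_card by (intro mult_le_mono) (auto simp: H_def)
  also have "3 ^ H * 3 ^ H * 25 ^ (n + H) = (225::nat) ^ H * 25 ^ n"
    by (simp add: power_add mult_ac flip: power_mult_distrib)
  finally show ?thesis by (simp add: H_def)
qed

text \<open>An infinite set has \<open>card\<close> 0 and the supremum of no numbers is 0, so both
  degenerate cases satisfy the bound.\<close>

lemma crossing_number_le:
  assumes "smooth_circle n S \<or> smooth_arc n S" "wf_act n 0 t" "tests_membership n t S"
  shows "crossing_number n S \<le> 225 ^ act_height t * 25 ^ n"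
proof -
  let ?f = "\<lambda>L. card (singular_points n (proj n L ` S))"
  have le: "?f L \<le> 225 ^ act_height t * 25 ^ n" if "generic_plane n S L" for L
  proof (cases "finite (singular_points n (proj n L ` S))")
    case True
    then show ?thesis
      using that assms card_double_points_le unfolding generic_plane_def by blast
  qed simp
  show ?thesis
  proof (cases "{L. generic_plane n S L} = {}")
    case True
    then show ?thesis by (simp only: crossing_number_def True) (simp add: Sup_nat_def)
  next
    case False
    then show ?thesis unfolding crossing_number_def using le by (intro cSUP_least) auto
  qed
qed

theorem theorem5p1:
  shows "\<exists>c1 c2 :: real. c1 > 0 \<and> c2 > 0 \<and>
    (\<forall>(n :: nat) (\<Sigma> :: (nat \<Rightarrow> real) set) (t :: act).
       smooth_bounded_semialgebraic_curve n \<Sigma> \<and> crossing_number n \<Sigma> \<ge> 1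
       \<and> wf_act n 0 t \<and> tests_membership n t \<Sigma>
       \<longrightarrow> real (act_height t) \<ge> c1 * ln (real (crossing_number n \<Sigma>)) - c2 * real n)"
proof (intro exI conjI allI impI)
  \<comment> \<open>Taking logarithms in \<open>?C \<le> 225 ^ ?h * 25 ^ n\<close> and solving for
    \<open>?h\<close> yields these constants.\<close>
  show "1 / ln 225 > (0::real)" "ln 25 / ln 225 > (0::real)" by simp_all
  fix n :: nat and \<Sigma> :: "(nat \<Rightarrow> real) set" and t :: act
  assume *: "smooth_bounded_semialgebraic_curve n \<Sigma> \<and> crossing_number n \<Sigma> \<ge> 1
       \<and> wf_act n 0 t \<and> tests_membership n t \<Sigma>"
  let ?C = "crossing_number n \<Sigma>" and ?h = "act_height t"
  have "?C \<le> 225 ^ ?h * 25 ^ n"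
    using * crossing_number_le by (auto simp: smooth_bounded_semialgebraic_curve_def)
  then have "real ?C \<le> 225 ^ ?h * 25 ^ n"
    using of_nat_mono[of ?C "225 ^ ?h * 25 ^ n", where 'a = real] by simp
  moreover have "real ?C > 0" using * by simp
  ultimately have "ln (real ?C) \<le> ln (225 ^ ?h * 25 ^ n)" by (simp add: ln_mono)
  also have "\<dots> = real ?h * ln 225 + real n * ln 25" by (simp add: ln_mult ln_realpow)
  finally have "ln (real ?C) / ln 225 \<le> (real ?h * ln 225 + real n * ln 25) / ln 225"
    by (intro divide_right_mono) simp_all
  also have "\<dots> = real ?h + ln 25 / ln 225 * real n" by (simp add: add_divide_distrib)
  finally show "real ?h \<ge> 1 / ln 225 * ln (real ?C) - ln 25 / ln 225 * real n" by simp
qed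

end
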